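(* Let $\mathcal S=\{f,\underline p,\bar p\}$ be a convex setup. There exists a unique optimal critical threshold $\omega_*$ so that the following claims hold: 1. The optimal competitive ratio $\alpha_*(\mathcal S)$ is given by $$\alpha_*(\mathcal S)=\frac{h(\underline p)}{F_{\underline p}(\omega_* )}=\begin{cases}\dfrac{\underline p\,f'^{-1}(\underline p)-f(f'^{-1}(\underline p))}{\underline p\,\omega_*-f(\omega_* )} & \text{if }\underline p\in(\underline c,\bar c),\\[3mm]\dfrac{\underline p-f(1)}{\underline p\,\omega_*-f(\omega_* )} & \text{if }\underline p\in[\bar c,+\infty).\end{cases}$$ 2. There exists a unique optimal pricing function $\phi_*$ given by $$\phi_*(y)=\begin{cases}\underline p & \text{if }y\in[0,\omega_* ),\\ \varphi_*(y) & \text{if }y\in[\omega_*,\bar\rho],\\+\infty & \text{if }y\in(\bar\rho,+\infty),\end{cases}$$ so that $\mathsf{PM}_{\phi_*}$ is incentive compatible and $\alpha_*(\mathcal S)$-competitive. Here $\varphi_*$ is the unique strictly increasing solution to the boundary value problem $$\begin{cases}\varphi'(y)=\alpha_*(\mathcal S)\cdot\dfrac{\varphi(y)-f'(y)}{h'(\varphi(y))}, & y\in(\omega_*,\bar\rho),\\[2mm]\varphi(\omega_* )=\underline p,\quad\varphi(\bar\rho)\ge\bar p.\end{cases}$$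
   Context: **Setup.** A setup is $\mathcal S=\{f,\underline p,\bar p\}$, consisting of a supply cost function $f$ on $[0,1]$ and bounds $\underline p\le\bar p$; this is all the information known in advance. It is *convex* if $f$ is non-decreasing, strictly convex and differentiable, $f(0)=0$ and $f'(0)<\underline p\le\bar p$. Put $\underline c=f'(0)$, $\bar c=f'(1)$; $\bar f=f$ on $[0,1]$ and $\bar f=+\infty$ on $(1,\infty)$; $F_p(y)=py-\bar f(y)$; $h(p)=\max_{y\ge0}F_p(y)$, with derivative $h'$ ($h'(p)=f'^{-1}(p)$ for $p\in[\underline c,\bar c]$ and $h'(p)=1$ for $p>\bar c$); $\bar\rho=\arg\max_{y\ge0}F_{\bar p}(y)$. The critical threshold is the resource utilization level separating the flat segment (price $\underline p$) of a pricing function from its increasing segment. **Model.** An arrival instance $\mathcal A=(\theta_1,\dots,\theta_N)$ is a sequence of agents arriving one by one, with types $\theta_n=(r_n,v_n)$, where $r_n$ is the resource requirement and $v_n$ the valuation, such that $\underline p\le v_n/r_n\le\bar p$ for all $n$. Every requirement is assumed very small compared with the capacity: $r_n\ll1$ (requests are treated as infinitesimal). With $x_n\in\{0,1\}$ indicating whether request $n$ is satisfied, the social welfare is $\sum_n v_nx_n-f(\sum_n r_nx_n)$ subject to $\sum_n r_nx_n\le1$; $S_{\rm offline}(\mathcal A)$ is its maximum given full knowledge of $\mathcal A$. An online algorithm or mechanism knows only $\mathcal S$ in advance and decides each $x_n$ irrevocably upon arrival of agent $n$; $S_{\rm online}(\mathcal A)$ is the social welfare it achieves. Its competitive ratio is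 $\max_{\mathcal A}S_{\rm offline}(\mathcal A)/S_{\rm online}(\mathcal A)$ over all possible $\mathcal A$; it is $\alpha$-competitive if this ratio is at most $\alpha$. The optimal competitive ratio $\alpha_*(\mathcal S)$ is the infimum of the competitive ratio over all possible online algorithms. **Posted price mechanism $\mathsf{PM}_\phi$.** Given a pricing function $\phi$, start with $\hat y_0=0$, $\hat p_0=\phi(0)$. When agent $n$ arrives: if $v_n-\hat p_{n-1}r_n<0$ or $\hat y_{n-1}+r_n>1$, set $\hat x_n=0$; otherwise $\hat x_n=1$. Agent $n$ pays $\hat p_{n-1}r_n\hat x_n$; then $\hat y_n=\hat y_{n-1}+r_n\hat x_n$ and $\hat p_n=\phi(\hat y_n)$. **Incentive compatibility.** Agents may misreport their types. The utility of agent $n$ is $v_nx_n$ minus her payment. A mechanism is incentive compatible if all agents achieve their maximum utilities by acting according to their true types. *)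

theory Defs
  imports "HOL-Analysis.Analysis"
begin

text \<open>The cost function \<open>f\<close> is only ever used on the unit interval; derivatives at the
  endpoints are one-sided.\<close>

definition marginal :: "(real \<Rightarrow> real) \<Rightarrow> real \<Rightarrow> real" where
  "marginal f y = vector_derivative f (at y within {0..1})"

definition convex_setup :: "(real \<Rightarrow> real) \<Rightarrow> real \<Rightarrow> real \<Rightarrow> bool" where
  "convex_setup f pl pu \<longleftrightarrow>
     mono_on {0..1} f \<and>
     (\<forall>x\<in>{0..1}. \<forall>y\<in>{0..1}. \<forall>t\<in>{0<..<1}. x \<noteq> y \<longrightarrow>
        f ((1 - t) * x + t * y) < (1 - t) * f x + t * f y) \<and>
     f differentiable_on {0..1} \<and>
     f 0 = 0 \<and> marginal f 0 < pl \<and> pl \<le> pu"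

definition fbar :: "(real \<Rightarrow> real) \<Rightarrow> real \<Rightarrow> ereal" where
  "fbar f y = (if y \<le> 1 then ereal (f y) else \<infinity>)"

definition profit :: "(real \<Rightarrow> real) \<Rightarrow> real \<Rightarrow> real \<Rightarrow> ereal" where
  "profit f p y = ereal (p * y) - fbar f y"

definition h :: "(real \<Rightarrow> real) \<Rightarrow> real \<Rightarrow> real" where
  "h f p = real_of_ereal (SUP y\<in>{0..}. profit f p y)"

definition rho_bar :: "(real \<Rightarrow> real) \<Rightarrow> real \<Rightarrow> real" where
  "rho_bar f pu = arg_max_on (profit f pu) {0..}"

text \<open>An agent is a pair \<open>(r, v)\<close> of resource requirement and valuation.\<close>

type_synonym agent = "real \<times> real"

definition valid_agent :: "real \<Rightarrow> real \<Rightarrow> agent \<Rightarrow> bool" where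
  "valid_agent pl pu \<theta> \<longleftrightarrow> 0 < fst \<theta> \<and> pl \<le> snd \<theta> / fst \<theta> \<and> snd \<theta> / fst \<theta> \<le> pu"

definition instances :: "real \<Rightarrow> real \<Rightarrow> real \<Rightarrow> agent list set" where
  "instances pl pu \<epsilon> = {A. \<forall>\<theta>\<in>set A. valid_agent pl pu \<theta> \<and> fst \<theta> \<le> \<epsilon>}"

definition demand :: "agent list \<Rightarrow> nat set \<Rightarrow> real" where
  "demand A X = (\<Sum>n\<in>X. fst (A ! n))"

definition welfare :: "(real \<Rightarrow> real) \<Rightarrow> agent list \<Rightarrow> nat set \<Rightarrow> real" where
  "welfare f A X = (\<Sum>n\<in>X. snd (A ! n)) - f (demand A X)"

definition offline_welfare :: "(real \<Rightarrow> real) \<Rightarrow> agent list \<Rightarrow> real" where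
  "offline_welfare f A = Max (welfare f A ` {X. X \<subseteq> {..<length A} \<and> demand A X \<le> 1})"

text \<open>An algorithm maps the sequence of types seen so far, the current agent being the last
  one, to the decision on the current agent.\<close>

type_synonym algorithm = "agent list \<Rightarrow> bool"

definition accepted :: "algorithm \<Rightarrow> agent list \<Rightarrow> nat set" where
  "accepted alg A = {n. n < length A \<and> alg (take (Suc n) A)}"

definition online_algorithm :: "real \<Rightarrow> real \<Rightarrow> algorithm \<Rightarrow> bool" where
  "online_algorithm pl pu alg \<longleftrightarrow>
     (\<forall>A. (\<forall>\<theta>\<in>set A. valid_agent pl pu \<theta>) \<longrightarrow> demand A (accepted alg A) \<le> 1)"

definition online_welfare :: "(real \<Rightarrow> real) \<Rightarrow> algorithm \<Rightarrow> agent list \<Rightarrow> real" where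
  "online_welfare f alg A = welfare f A (accepted alg A)"

text \<open>The quotient of offline and online welfare. A non-positive online welfare must not
  yield a favourable (zero or negative) ratio: it counts as infinitely bad, unless
  both welfares are \<open>0\<close>, in which case the algorithm is optimal.\<close>

definition welfare_ratio :: "(real \<Rightarrow> real) \<Rightarrow> algorithm \<Rightarrow> agent list \<Rightarrow> ereal" where
  "welfare_ratio f alg A =
     (if 0 < online_welfare f alg A
      then ereal (offline_welfare f A / online_welfare f alg A)
      else if online_welfare f alg A = offline_welfare f A then 1 else \<infinity>)"

text \<open>Infinitesimal requests: the worst-case ratio over instances whose requirements are all at
  most \<open>\<epsilon>\<close>, in the limit \<open>\<epsilon> \<longrightarrow> 0\<close>. As the supremum is monotone in \<open>\<epsilon>\<close>, this limit is the
  infimum over \<open>\<epsilon> > 0\<close>. For the same reason it makes no difference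
  to \<open>optimal_ratio\<close> whether algorithms are allowed to depend on \<open>\<epsilon>\<close>.\<close>

definition competitive_ratio ::
  "(real \<Rightarrow> real) \<Rightarrow> real \<Rightarrow> real \<Rightarrow> algorithm \<Rightarrow> ereal" where
  "competitive_ratio f pl pu alg =
     (INF \<epsilon>\<in>{0<..}. SUP A\<in>instances pl pu \<epsilon>. welfare_ratio f alg A)"

definition competitive ::
  "(real \<Rightarrow> real) \<Rightarrow> real \<Rightarrow> real \<Rightarrow> ereal \<Rightarrow> algorithm \<Rightarrow> bool" where
  "competitive f pl pu \<alpha> alg \<longleftrightarrow>
     online_algorithm pl pu alg \<and> competitive_ratio f pl pu alg \<le> \<alpha>"

definition optimal_ratio :: "(real \<Rightarrow> real) \<Rightarrow> real \<Rightarrow> real \<Rightarrow> ereal" where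
  "optimal_ratio f pl pu = (INF alg\<in>{alg. online_algorithm pl pu alg}. competitive_ratio f pl pu alg)"

text \<open>A mechanism consists of an allocation rule and a payment rule, both applied to the sequence
  of reports up to and including the current one.\<close>

type_synonym mechanism = "algorithm \<times> (agent list \<Rightarrow> ereal)"

text \<open>The agent of true type \<open>\<theta>\<close> reports \<open>\<theta>'\<close> after the reports \<open>H\<close>. Acceptance of the report
  allocates the amount \<open>fst \<theta>'\<close>, so the true request is satisfied only if this amount
  covers the true requirement.\<close>

definition utility :: "mechanism \<Rightarrow> agent list \<Rightarrow> agent \<Rightarrow> agent \<Rightarrow> ereal" where
  "utility M H \<theta> \<theta>' =
     (if fst M (H @ [\<theta>']) \<and> fst \<theta> \<le> fst \<theta>' then ereal (snd \<theta>) else 0) - snd M (H @ [\<theta>'])"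

definition incentive_compatible :: "real \<Rightarrow> real \<Rightarrow> mechanism \<Rightarrow> bool" where
  "incentive_compatible pl pu M \<longleftrightarrow>
     (\<forall>H \<theta> \<theta>'. (\<forall>\<eta>\<in>set H. 0 < fst \<eta>) \<and> valid_agent pl pu \<theta> \<and> 0 < fst \<theta>'
        \<longrightarrow> utility M H \<theta> \<theta>' \<le> utility M H \<theta> \<theta>)"

definition pm_accept :: "(real \<Rightarrow> ereal) \<Rightarrow> real \<Rightarrow> agent \<Rightarrow> bool" where
  "pm_accept \<phi> y \<theta> \<longleftrightarrow> \<not> (ereal (snd \<theta>) - \<phi> y * ereal (fst \<theta>) < 0 \<or> y + fst \<theta> > 1)"

definition pm_util :: "(real \<Rightarrow> ereal) \<Rightarrow> agent list \<Rightarrow> real" where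
  "pm_util \<phi> A = foldl (\<lambda>y \<theta>. y + fst \<theta> * (if pm_accept \<phi> y \<theta> then 1 else 0)) 0 A"

definition pm_alloc :: "(real \<Rightarrow> ereal) \<Rightarrow> algorithm" where
  "pm_alloc \<phi> A \<longleftrightarrow> pm_accept \<phi> (pm_util \<phi> (butlast A)) (last A)"

text \<open>Rejected agents pay nothing even at price \<open>\<infinity>\<close>, since \<open>\<infinity> * 0 = 0\<close> in \<^typ>\<open>ereal\<close>.\<close>

definition pm_pay :: "(real \<Rightarrow> ereal) \<Rightarrow> agent list \<Rightarrow> ereal" where
  "pm_pay \<phi> A =
     \<phi> (pm_util \<phi> (butlast A)) * ereal (fst (last A)) * (if pm_alloc \<phi> A then 1 else 0)"

definition PM :: "(real \<Rightarrow> ereal) \<Rightarrow> mechanism" where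
  "PM \<phi> = (pm_alloc \<phi>, pm_pay \<phi>)"

definition optimal_pricing :: "(real \<Rightarrow> real) \<Rightarrow> real \<Rightarrow> real \<Rightarrow> (real \<Rightarrow> ereal) \<Rightarrow> bool" where
  "optimal_pricing f pl pu \<phi> \<longleftrightarrow>
     incentive_compatible pl pu (PM \<phi>) \<and>
     competitive f pl pu (optimal_ratio f pl pu) (fst (PM \<phi>))"

text \<open>\<open>\<omega>\<close> separates the flat segment of \<open>\<phi>\<close> at price \<open>pl\<close> from its increasing segment, which
  extends up to the utilization \<open>rho_bar f pu\<close> that is never worth exceeding. Without such a
  normal form, optimal pricing functions are not unique: lowering
  prices below \<open>pl\<close> on the flat segment, say, has no effect on the allocation.\<close>

definition critical_threshold ::
  "(real \<Rightarrow> real) \<Rightarrow> real \<Rightarrow> real \<Rightarrow> (real \<Rightarrow> ereal) \<Rightarrow> real \<Rightarrow> bool" where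
  "critical_threshold f pl pu \<phi> \<omega> \<longleftrightarrow>
     \<omega> \<in> {0..rho_bar f pu} \<and>
     (\<forall>y\<in>{0..\<omega>}. \<phi> y = ereal pl) \<and>
     continuous_on {\<omega>..rho_bar f pu} \<phi> \<and>
     strict_mono_on {\<omega>..rho_bar f pu} \<phi> \<and>
     (\<forall>y>rho_bar f pu. \<phi> y = \<infinity>)"

definition optimal_threshold :: "(real \<Rightarrow> real) \<Rightarrow> real \<Rightarrow> real \<Rightarrow> real \<Rightarrow> bool" where
  "optimal_threshold f pl pu \<omega> \<longleftrightarrow>
     (\<exists>\<phi>. critical_threshold f pl pu \<phi> \<omega> \<and> optimal_pricing f pl pu \<phi>)"

text \<open>Strictly increasing solutions of the boundary value problem. Continuity on the closed
  interval ties the boundary values to the differential equation on its interior.\<close>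

definition bvp_solution ::
  "(real \<Rightarrow> real) \<Rightarrow> real \<Rightarrow> real \<Rightarrow> real \<Rightarrow> (real \<Rightarrow> real) \<Rightarrow> bool" where
  "bvp_solution f pl pu \<omega> g \<longleftrightarrow>
     continuous_on {\<omega>..rho_bar f pu} g \<and>
     strict_mono_on {\<omega>..rho_bar f pu} g \<and>
     (\<forall>y\<in>{\<omega><..<rho_bar f pu}.
        (g has_real_derivative
           real_of_ereal (optimal_ratio f pl pu) * ((g y - marginal f y) / deriv (h f) (g y)))
        (at y)) \<and>
     g \<omega> = pl \<and> pu \<le> g (rho_bar f pu)"

definition pricing_function ::
  "(real \<Rightarrow> real) \<Rightarrow> real \<Rightarrow> real \<Rightarrow> real \<Rightarrow> (real \<Rightarrow> real) \<Rightarrow> real \<Rightarrow> ereal" where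
  "pricing_function f pl pu \<omega> g y =
     (if y < \<omega> then ereal pl else if y \<le> rho_bar f pu then ereal (g y) else \<infinity>)"

end

theory Submission
  imports Defs
begin

text \<open>Let \<open>\<Psi>\<close> be the revenue collected by a price \<open>\<phi>\<close> up to a given utilization. Stopping the
  arrivals at density \<open>p\<close> forces \<open>\<alpha> (\<Psi> y - f y) \<ge> h p\<close> where \<open>\<phi> y = p\<close>, and the optimal price
  satisfies this with equality: \<open>\<Psi>' = h\<inverse> (\<alpha> (\<Psi> - f))\<close>. With \<open>h\<inverse>\<close> clamped to \<open>[pl, pu]\<close> this is a
  monotone Lipschitz initial value problem on all of \<open>[0, 1]\<close> with \<open>\<Psi> 0 = 0\<close>: the flat segment is
  the part where the clamp is active and \<open>\<omega>\<close> is the point where \<open>\<alpha> (\<Psi> - f)\<close> reaches \<open>h pl\<close>. The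
  ratio \<open>\<alpha>\<close> is fixed by requiring that \<open>\<alpha> (\<Psi> - f)\<close> reaches \<open>h pu\<close> exactly at \<open>rho_bar f pu\<close>.

  The slope inequality \<open>\<phi> a (b - a) \<le> \<Psi> b - \<Psi> a\<close> and \<open>\<alpha> (\<Psi> - f) \<le> h \<circ> \<phi>\<close> give the lower bound: an
  algorithm with a smaller ratio, run on slowly increasing densities, must always have used so
  much that \<open>\<phi>\<close> exceeds the next density, hence earns at most \<open>\<Psi>\<close>, and fails at density \<open>pu\<close>. For
  another optimal price the same instances yield a differential inequality, and comparison with
  \<open>\<Psi>\<close> leaves no slack at \<open>rho_bar f pu\<close>.\<close>

subsection \<open>Calculus\<close>

text \<open>The boundary value problem for the price has two unknown data, the threshold and the
  ratio, and a right-hand side containing \<open>1 / h'\<close>, where \<open>h'\<close> is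
  continuous but need not be Lipschitz. For the revenue \<Psi> only the inverse of \<open>h\<close>
  occurs. It is Lipschitz on prices from \<open>pl\<close> on, since there \<open>h\<close> has
  slope at least \<open>rho_bar f pl\<close>, which is positive because
  \<open>marginal f 0 < pl\<close>; hence the constant \<open>1 / rho_bar f pl\<close> throughout.
  Moreover \<omega> becomes an output, and \<alpha> is the only parameter left for an intermediate
  value argument. That the price attains \<alpha> is weak duality: offline welfare is at most the
  buyers' surplus over posted prices plus \<open>h\<close> at the final price. The obstacle is that
  requests of size \<epsilon> cause additive errors while a ratio is multiplicative. Either the
  final utilization stays below \<omega> by more than \<epsilon>, and then everything is accepted
  and the outcome is offline optimal, or the net revenue in the estimate is at least
  \<open>H pl / \<alpha>\<close>, so that the error becomes relative. Revenues are compared by a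
  one-sided Gronwall argument that controls the derivative only where the sign is already
  wrong.\<close>

lemma DERIV_within_le:
  fixes g :: "real \<Rightarrow> real"
  assumes "(g has_real_derivative D) (at x within S)" "T \<subseteq> S" "x islimpt T"
    and "\<And>y. y \<in> T \<Longrightarrow> y \<noteq> x \<Longrightarrow> (g y - g x) / (y - x) \<le> c"
  shows "D \<le> c"
proof -
  have "(g has_real_derivative D) (at x within T)"
    using assms(1,2) by (rule DERIV_subset)
  then have "((\<lambda>y. (g y - g x) / (y - x)) \<longlongrightarrow> D) (at x within T)"
    by (simp add: has_field_derivative_iff)
  moreover have "\<forall>\<^sub>F y in at x within T. (g y - g x) / (y - x) \<le> c"
    using assms(4) by (auto simp: eventually_at_filter)
  moreover have "at x within T \<noteq> bot"
    using assms(3) by (simp add: trivial_limit_within)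
  ultimately show ?thesis
    by (metis tendsto_upperbound)
qed

lemma DERIV_within_ge:
  fixes g :: "real \<Rightarrow> real"
  assumes "(g has_real_derivative D) (at x within S)" "T \<subseteq> S" "x islimpt T"
    and "\<And>y. y \<in> T \<Longrightarrow> y \<noteq> x \<Longrightarrow> c \<le> (g y - g x) / (y - x)"
  shows "c \<le> D"
proof -
  have "- D \<le> - c"
  proof (rule DERIV_within_le)
    show "((\<lambda>x. - g x) has_real_derivative - D) (at x within S)"
      using assms(1) by (rule DERIV_minus)
    show "(- g y - - g x) / (y - x) \<le> - c" if "y \<in> T" "y \<noteq> x" for y
      using assms(4)[OF that] by (simp add: diff_divide_distrib)
  qed (use assms in auto)
  then show ?thesis by simp
qed

lemma islimpt_greaterThanLessThan_ends:
  fixes a b :: real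
  assumes "a < b"
  shows "a islimpt {a<..<b}" "b islimpt {a<..<b}"
  using islimpt_greaterThanLessThan1[OF assms] islimpt_greaterThanLessThan2[OF assms] by auto

lemma increment_le:
  fixes g :: "real \<Rightarrow> real"
  assumes "a \<le> b" "continuous_on {a..b} g"
    and "\<And>x. a < x \<Longrightarrow> x < b \<Longrightarrow> (g has_real_derivative g' x) (at x)"
    and "\<And>x. a < x \<Longrightarrow> x < b \<Longrightarrow> g' x \<le> c"
  shows "g b - g a \<le> c * (b - a)"
proof -
  have "c * a - g a \<le> c * b - g b"
  proof (rule DERIV_nonneg_imp_increasing_open[of a b "\<lambda>x. c * x - g x"])
    show "\<exists>y. ((\<lambda>x. c * x - g x) has_real_derivative y) (at x) \<and> 0 \<le> y"
      if "a < x" "x < b" for x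
      using assms(3,4)[OF that]
      by (intro exI[of _ "c - g' x"]) (auto intro!: derivative_eq_intros)
  qed (use assms in \<open>auto intro!: continuous_intros\<close>)
  then show ?thesis by (simp add: algebra_simps)
qed

lemma increment_ge:
  fixes g :: "real \<Rightarrow> real"
  assumes "a \<le> b" "continuous_on {a..b} g"
    and "\<And>x. a < x \<Longrightarrow> x < b \<Longrightarrow> (g has_real_derivative g' x) (at x)"
    and "\<And>x. a < x \<Longrightarrow> x < b \<Longrightarrow> c \<le> g' x"
  shows "c * (b - a) \<le> g b - g a"
proof -
  have "- g b - - g a \<le> - c * (b - a)"
    using assms
    by (intro increment_le[where g' = "\<lambda>x. - g' x"] continuous_on_minus DERIV_minus) auto
  then show ?thesis by simp
qed

text \<open>After the last time at which \<open>D\<close> is nonnegative, the hypothesis applies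
  throughout and \<open>exp (- K * t) * D t\<close> cannot decrease, so \<open>D\<close> never
  becomes negative. Asking for the derivative bound only where \<open>D t < 0\<close> lets callers
  use the sign when they prove it.\<close>

lemma nonneg_by_gronwall:
  fixes D :: "real \<Rightarrow> real"
  assumes "a \<le> b" and cont: "continuous_on {a..b} D" and "0 \<le> D a"
    and deriv: "\<And>t. a < t \<Longrightarrow> t < b \<Longrightarrow> D t < 0 \<Longrightarrow>
      \<exists>D'. (D has_real_derivative D') (at t) \<and> K * D t \<le> D'"
  shows "0 \<le> D b"
proof (rule ccontr)
  assume "\<not> 0 \<le> D b"
  define S where "S = {t \<in> {a..b}. 0 \<le> D t}"
  have "S = {a..b} \<inter> D -` {0..}" by (auto simp: S_def)
  then have "closed S"
    using continuous_closed_preimage[OF cont closed_atLeastAtMost closed_atLeast] by simp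
  moreover have "bdd_above S" "S \<noteq> {}"
    using assms by (auto simp: S_def intro!: bdd_aboveI[of _ b])
  ultimately have s: "Sup S \<in> S" by (intro closed_contains_Sup)
  define s where "s = Sup S"
  have sD: "a \<le> s" "s \<le> b" "0 \<le> D s" using s by (auto simp: S_def s_def)
  have "s < b" using sD \<open>\<not> 0 \<le> D b\<close> by (cases "s = b") auto
  have neg: "D t < 0" if "s < t" "t \<le> b" for t
  proof (rule ccontr)
    assume "\<not> D t < 0"
    then have "t \<in> S" using that sD by (auto simp: S_def)
    then have "t \<le> s" unfolding s_def using \<open>bdd_above S\<close> by (rule cSup_upper)
    then show False using that by simp
  qed
  define E where "E t = exp (- K * t) * D t" for t
  have "E s \<le> E b"
  proof (rule DERIV_nonneg_imp_increasing_open[of s b E])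
    show "s \<le> b" using \<open>s < b\<close> by simp
    show "continuous_on {s..b} E" unfolding E_def
      using cont sD by (auto intro!: continuous_intros elim: continuous_on_subset)
    show "\<exists>y. (E has_real_derivative y) (at t) \<and> 0 \<le> y" if t: "s < t" "t < b" for t
    proof -
      obtain D' where D': "(D has_real_derivative D') (at t)" "K * D t \<le> D'"
        using deriv[of t] neg[of t] t sD by auto
      have "(E has_real_derivative exp (- K * t) * (D' - K * D t)) (at t)"
        unfolding E_def by (auto intro!: derivative_eq_intros D'(1) simp: algebra_simps)
      then show ?thesis using D'(2) by (intro exI conjI) auto
    qed
  qed
  moreover have "0 \<le> E s" using sD by (simp add: E_def)
  moreover have "E b < 0" using \<open>\<not> 0 \<le> D b\<close> by (simp add: E_def mult_pos_neg)
  ultimately show False by simp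
qed

text \<open>Monotonicity in the state replaces a contraction: Picard iteration started from a
  subsolution increases pointwise, is bounded by the line of slope \<open>d\<close>, and its limit
  solves the integral equation by dominated convergence.\<close>

lemma monotone_ode_exists:
  fixes F :: "real \<Rightarrow> real \<Rightarrow> real"
  assumes "a \<le> b"
    and cont: "continuous_on ({a..b} \<times> UNIV) (\<lambda>(t, x). F t x)"
    and mono: "\<And>t x y. t \<in> {a..b} \<Longrightarrow> x \<le> y \<Longrightarrow> F t x \<le> F t y"
    and bounds: "\<And>t x. t \<in> {a..b} \<Longrightarrow> c \<le> F t x" "\<And>t x. t \<in> {a..b} \<Longrightarrow> F t x \<le> d"
  shows "\<exists>w. w a = 0 \<and>
    (\<forall>t\<in>{a..b}. (w has_real_derivative F t (w t)) (at t within {a..b}))"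
proof -
  \<comment> \<open>The start \<open>c * (t - a)\<close> is a subsolution because \<open>c\<close>
    bounds \<open>F\<close> from below; this begins the induction that the iterates
    increase.\<close>
  define W where
    "W n = rec_nat (\<lambda>t. c * (t - a)) (\<lambda>_ v t. integral {a..t} (\<lambda>s. F s (v s))) n" for n
  have W0: "W 0 = (\<lambda>t. c * (t - a))"
    and WS: "\<And>n. W (Suc n) = (\<lambda>t. integral {a..t} (\<lambda>s. F s (W n s)))"
    by (simp_all add: W_def)
  have comp: "continuous_on {a..b} (\<lambda>s. F s (v s))" if "continuous_on {a..b} v" for v
  proof -
    have "continuous_on {a..b} ((\<lambda>(t, x). F t x) \<circ> (\<lambda>s. (s, v s)))"
      by (rule continuous_on_compose)
         (auto intro!: continuous_intros that continuous_on_subset[OF cont])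
    then show ?thesis by (simp add: o_def)
  qed
  have int: "(\<lambda>s. F s (v s)) integrable_on {a..t}" if "continuous_on {a..b} v" "t \<le> b" for v t
    using comp[OF that(1)] that(2)
    by (intro integrable_continuous_interval) (auto elim: continuous_on_subset)
  have Wcont: "continuous_on {a..b} (W n)" for n
  proof (induction n)
    case 0
    show ?case by (auto simp: W0 intro!: continuous_intros)
  next
    case (Suc n)
    then show ?case unfolding WS
      by (intro indefinite_integral_continuous_1 int) auto
  qed
  have upper: "W (Suc n) t \<le> d * (t - a)" if "t \<in> {a..b}" for n t
  proof -
    have "integral {a..t} (\<lambda>s. F s (W n s)) \<le> integral {a..t} (\<lambda>s. d)"
      using that by (intro integral_le int Wcont) (auto intro: bounds)
    then show ?thesis using that by (simp add: WS mult.commute)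
  qed
  have step: "W n t \<le> W (Suc n) t" if "t \<in> {a..b}" for n t
    using that
  proof (induction n arbitrary: t)
    case 0
    have "integral {a..t} (\<lambda>s. c) \<le> integral {a..t} (\<lambda>s. F s (W 0 s))"
      using 0 by (intro integral_le int Wcont) (auto intro: bounds)
    then show ?case using 0 by (simp add: WS W0 mult.commute)
  next
    case (Suc n)
    have "integral {a..t} (\<lambda>s. F s (W n s)) \<le> integral {a..t} (\<lambda>s. F s (W (Suc n) s))"
      using Suc by (intro integral_le int Wcont) (auto intro: mono)
    then show ?case by (simp add: WS)
  qed
  define w where "w t = lim (\<lambda>n. W n t)" for t
  have lim: "(\<lambda>n. W n t) \<longlonglongrightarrow> w t" if "t \<in> {a..b}" for t
  proof -
    have "incseq (\<lambda>n. W n t)" using step[OF that] by (intro incseq_SucI) auto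
    moreover have "\<And>n. W n t \<le> d * (t - a)"
      using step[OF that] upper[OF that] order_trans by blast
    ultimately have "convergent (\<lambda>n. W n t)"
      by (meson convergentI incseq_convergent)
    then show ?thesis by (simp add: w_def convergent_LIMSEQ_iff)
  qed
  have fixpoint: "(\<lambda>s. F s (w s)) integrable_on {a..t} \<and> w t = integral {a..t} (\<lambda>s. F s (w s))"
    if t: "t \<in> {a..b}" for t
  proof -
    have conv: "(\<lambda>n. F s (W n s)) \<longlonglongrightarrow> F s (w s)" if "s \<in> {a..t}" for s
    proof -
      have s: "s \<in> {a..b}" using that t by auto
      have "(\<lambda>n. (s, W n s)) \<longlonglongrightarrow> (s, w s)" by (intro tendsto_intros lim s)
      from continuous_on_tendsto_compose[OF cont this]
      show ?thesis using s by simp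
    qed
    have bd: "norm (F s (W n s)) \<le> max \<bar>c\<bar> \<bar>d\<bar>" if "s \<in> {a..t}" for n s
      using bounds[of s "W n s"] that t by auto
    have I: "(\<lambda>s. F s (W n s)) integrable_on {a..t}" for n using Wcont t by (intro int) auto
    have "(\<lambda>s. F s (w s)) integrable_on {a..t}"
      and L: "(\<lambda>n. integral {a..t} (\<lambda>s. F s (W n s))) \<longlonglongrightarrow> integral {a..t} (\<lambda>s. F s (w s))"
      using dominated_convergence[of "\<lambda>n s. F s (W n s)" "{a..t}" "\<lambda>_. max \<bar>c\<bar> \<bar>d\<bar>" "\<lambda>s. F s (w s)"]
        I bd conv by auto
    moreover have "(\<lambda>n. integral {a..t} (\<lambda>s. F s (W n s))) \<longlonglongrightarrow> w t"
      using LIMSEQ_Suc[OF lim[OF t]] by (simp add: WS)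
    ultimately show ?thesis using LIMSEQ_unique by blast
  qed
  \<comment> \<open>So far \<open>w\<close> is only a pointwise limit. Its continuity comes from the
    integral equation, and only then does the fundamental theorem give the derivative.\<close>
  have "continuous_on {a..b} (\<lambda>t. integral {a..t} (\<lambda>s. F s (w s)))"
    using fixpoint[of b] \<open>a \<le> b\<close> by (intro indefinite_integral_continuous_1) auto
  then have wcont: "continuous_on {a..b} w"
    using fixpoint by (simp cong: continuous_on_cong_simp)
  have "(w has_real_derivative F t (w t)) (at t within {a..b})" if t: "t \<in> {a..b}" for t
  proof -
    have "((\<lambda>t. integral {a..t} (\<lambda>s. F s (w s))) has_real_derivative F t (w t)) (at t within {a..b})"
      using integral_has_real_derivative[OF comp[OF wcont] t] .
    then show ?thesis
      unfolding has_field_derivative_def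
      by (rule has_derivative_transform[rotated 2]) (use t fixpoint in auto)
  qed
  moreover have "w a = 0" using fixpoint[of a] \<open>a \<le> b\<close> by simp
  ultimately show ?thesis by blast
qed

subsection \<open>Convex costs\<close>

locale market =
  fixes f :: "real \<Rightarrow> real" and pl pu :: real
  assumes cvx: "convex_setup f pl pu"
begin

abbreviation "m \<equiv> marginal f"
abbreviation "\<rho> \<equiv> rho_bar f"
abbreviation "H \<equiv> h f"

lemma pl_le_pu: "pl \<le> pu" and m0_less_pl: "m 0 < pl" and f_0 [simp]: "f 0 = 0"
  and f_mono: "\<And>x y. 0 \<le> x \<Longrightarrow> x \<le> y \<Longrightarrow> y \<le> 1 \<Longrightarrow> f x \<le> f y"
  using cvx by (auto simp: convex_setup_def mono_on_def)

lemma f_strict: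
  assumes "x \<in> {0..1}" "y \<in> {0..1}" "x \<noteq> y" "0 < t" "t < 1"
  shows "f ((1 - t) * x + t * y) < (1 - t) * f x + t * f y"
  using cvx assms by (auto simp: convex_setup_def)

lemma f_deriv:
  assumes "y \<in> {0..1}"
  shows "(f has_real_derivative m y) (at y within {0..1})"
proof -
  have "f differentiable (at y within {0..1})"
    using cvx assms by (auto simp: convex_setup_def differentiable_on_def)
  then show ?thesis
    by (simp add: marginal_def vector_derivative_works has_real_derivative_iff_has_vector_derivative)
qed

lemma f_continuous: "continuous_on {0..1} f"
  using f_deriv by (rule DERIV_continuous_on)

lemma f_deriv_at: "0 < y \<Longrightarrow> y < 1 \<Longrightarrow> (f has_real_derivative m y) (at y)"
  using f_deriv[of y] by (simp add: at_within_Icc_at)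

text \<open>Parametrising the chord from \<open>x\<close> covers \<open>x < y\<close> and
  \<open>y < x\<close> at once; the tangent inequality needs both sides.\<close>

lemma chord_less:
  assumes "x \<in> {0..1}" "y \<in> {0..1}" "z \<in> open_segment x y"
  shows "f z < f x + (f y - f x) * ((z - x) / (y - x))"
proof -
  obtain t where t: "0 < t" "t < 1" "z = (1 - t) * x + t * y" "x \<noteq> y"
    using assms(3) by (auto simp: in_segment)
  have "z - x = t * (y - x)" by (simp add: t(3) algebra_simps)
  then have "(z - x) / (y - x) = t" using t(4) by simp
  moreover have "f z < (1 - t) * f x + t * f y"
    using f_strict[OF assms(1,2) t(4,1,2)] t(3) by simp
  ultimately show ?thesis by (simp only:) (simp add: algebra_simps)
qed

lemma tangent:
  assumes "x \<in> {0..1}" "y \<in> {0..1}"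
  shows "f x + m x * (y - x) \<le> f y"
proof (cases x y rule: linorder_cases)
  case less
  have "m x \<le> (f y - f x) / (y - x)"
  proof (rule DERIV_within_le[OF f_deriv[OF assms(1)]])
    show "{x<..<y} \<subseteq> {0..1}" using assms by auto
    show "x islimpt {x<..<y}" using less by (rule islimpt_greaterThanLessThan_ends)
    show "(f z - f x) / (z - x) \<le> (f y - f x) / (y - x)" if "z \<in> {x<..<y}" for z
      using chord_less[OF assms, of z] that less
      by (simp add: open_segment_eq_real_ivl divide_simps) (simp add: algebra_simps)
  qed
  then show ?thesis using less by (simp add: field_simps)
next
  case greater
  have "(f y - f x) / (y - x) \<le> m x"
  proof (rule DERIV_within_ge[OF f_deriv[OF assms(1)]])
    show "{y<..<x} \<subseteq> {0..1}" using assms by auto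
    show "x islimpt {y<..<x}" using greater by (rule islimpt_greaterThanLessThan_ends)
    show "(f y - f x) / (y - x) \<le> (f z - f x) / (z - x)" if "z \<in> {y<..<x}" for z
      using chord_less[OF assms, of z] that greater
      by (simp add: open_segment_eq_real_ivl divide_simps split: if_splits) (simp add: algebra_simps)
  qed
  then show ?thesis using greater by (simp add: field_simps)
qed simp

text \<open>The weak tangent bound at the midpoint lies below the value there, which strict
  convexity puts strictly below the chord.\<close>

lemma tangent_strict:
  assumes "x \<in> {0..1}" "y \<in> {0..1}" "x \<noteq> y"
  shows "f x + m x * (y - x) < f y"
proof -
  have "f x + m x * ((x + y) / 2 - x) \<le> f ((x + y) / 2)"
    using assms by (intro tangent) auto
  moreover have "f ((x + y) / 2) < (f x + f y) / 2"
    using f_strict[OF assms, of "1/2"] by (simp add: add_divide_distrib)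
  ultimately show ?thesis by (simp add: field_simps)
qed

lemma m_strict_mono:
  assumes "x \<in> {0..1}" "y \<in> {0..1}" "x < y"
  shows "m x < m y"
proof -
  have "f x + m x * (y - x) < f y" "f y + m y * (x - y) < f x"
    using assms by (auto intro: tangent_strict)
  then have "0 < (m y - m x) * (y - x)" by (simp add: algebra_simps)
  then show ?thesis using assms(3) by (simp add: zero_less_mult_iff)
qed

lemma m_mono: "x \<in> {0..1} \<Longrightarrow> y \<in> {0..1} \<Longrightarrow> x \<le> y \<Longrightarrow> m x \<le> m y"
  using m_strict_mono[of x y] by (cases "x = y") auto

lemma m_nonneg:
  assumes "x \<in> {0..1}"
  shows "0 \<le> m x"
proof -
  have "0 \<le> m 0"
  proof (rule DERIV_within_ge[OF f_deriv])
    show "0 islimpt {0<..<1::real}" by (rule islimpt_greaterThanLessThan_ends) simp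
    show "0 \<le> (f y - f 0) / (y - 0)" if "y \<in> {0<..<1}" for y
      using f_mono[of 0 y] that by simp
  qed auto
  then show ?thesis using m_mono[of 0 x] assms by simp
qed

lemma pl_pos: "0 < pl"
  using m0_less_pl m_nonneg[of 0] by simp

lemma f_lipschitz:
  assumes "x \<in> {0..1}" "y \<in> {0..1}"
  shows "\<bar>f x - f y\<bar> \<le> m 1 * \<bar>x - y\<bar>"
proof -
  have *: "\<bar>f x - f y\<bar> \<le> m 1 * \<bar>x - y\<bar>" if "x \<in> {0..1}" "y \<in> {0..1}" "x \<le> y" for x y
  proof -
    have "m y * (y - x) \<le> m 1 * (y - x)" using that by (intro mult_right_mono m_mono) auto
    moreover have "m y * (x - y) = - (m y * (y - x))" by (simp add: algebra_simps)
    ultimately have "f y - f x \<le> m 1 * (y - x)" using tangent[of y x] that by simp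
    then show ?thesis using f_mono[of x y] that by simp
  qed
  show ?thesis using *[of x y] *[of y x] assms by (cases "x \<le> y") (auto simp: abs_minus_commute)
qed

section \<open>The profit maximizer and the conjugate of the cost\<close>

lemma profit_eq: "y \<le> 1 \<Longrightarrow> profit f p y = ereal (p * y - f y)"
  and profit_beyond: "1 < y \<Longrightarrow> profit f p y = -\<infinity>"
  by (auto simp: profit_def fbar_def)

text \<open>\<open>rho_bar\<close> is a choice operator, so a maximizer must be exhibited first: it
  exists by compactness of the unit interval, and points beyond 1 have profit minus
  infinity.\<close>

lemma rho_argmax:
  "\<rho> p \<in> {0..1} \<and> (\<forall>y\<in>{0..1}. p * y - f y \<le> p * \<rho> p - f (\<rho> p))"
proof -
  have "continuous_on {0..1} (\<lambda>y. p * y - f y)"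
    by (intro continuous_intros f_continuous)
  then obtain x where x: "x \<in> {0..1}" "\<forall>y\<in>{0..1}. p * y - f y \<le> p * x - f x"
    using continuous_attains_sup[of "{0..1::real}" "\<lambda>y. p * y - f y"] by auto
  have "profit f p y \<le> profit f p x" if "0 \<le> y" for y
    using x that by (cases "y \<le> 1") (auto simp: profit_eq profit_beyond)
  then have "is_arg_max (profit f p) (\<lambda>y. y \<in> {0..}) x"
    using x by (auto simp: is_arg_max_def not_less)
  then have "is_arg_max (profit f p) (\<lambda>y. y \<in> {0..}) (\<rho> p)"
    unfolding rho_bar_def arg_max_on_def arg_max_def by (rule someI)
  then have r: "0 \<le> \<rho> p" "\<And>y. 0 \<le> y \<Longrightarrow> profit f p y \<le> profit f p (\<rho> p)"
    by (auto simp: is_arg_max_def not_less)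
  have "\<rho> p \<le> 1"
    using r(2)[of 0] by (cases "\<rho> p \<le> 1") (auto simp: profit_eq profit_beyond)
  then show ?thesis using r by (fastforce simp: profit_eq)
qed

lemma rho_nonneg: "0 \<le> \<rho> p" and rho_le_1: "\<rho> p \<le> 1"
  using rho_argmax[of p] by auto

lemma H_eq: "H p = p * \<rho> p - f (\<rho> p)"
proof -
  have "(SUP y\<in>{0..}. profit f p y) = ereal (p * \<rho> p - f (\<rho> p))"
  proof (rule SUP_eqI)
    show "profit f p y \<le> ereal (p * \<rho> p - f (\<rho> p))" if "y \<in> {0..}" for y
      using rho_argmax[of p] that by (cases "y \<le> 1") (auto simp: profit_eq profit_beyond)
    show "ereal (p * \<rho> p - f (\<rho> p)) \<le> z" if "\<And>y. y \<in> {0..} \<Longrightarrow> profit f p y \<le> z" for z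
      using that[of "\<rho> p"] rho_argmax[of p] by (simp add: profit_eq)
  qed
  then show ?thesis by (simp add: h_def)
qed

lemma H_ge: "y \<in> {0..1} \<Longrightarrow> p * y - f y \<le> H p"
  using rho_argmax[of p] by (simp add: H_eq)

text \<open>The quantity that is optimal at price \<open>p\<close> remains feasible at price
  \<open>q\<close>.\<close>

lemma H_subgradient: "H p + (q - p) * \<rho> p \<le> H q"
  using H_ge[of "\<rho> p" q] rho_argmax[of p] by (simp add: H_eq algebra_simps)

text \<open>One half of the first-order condition, from difference quotients on the left of the
  maximizer. The halves are kept apart because a maximizer at an endpoint satisfies only one of
  them.\<close>

lemma m_rho_le:
  assumes "0 < \<rho> p"
  shows "m (\<rho> p) \<le> p"
proof (rule DERIV_within_le[OF f_deriv])
  show "\<rho> p islimpt {0<..<\<rho> p}" using assms by (rule islimpt_greaterThanLessThan_ends)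
  show "(f y - f (\<rho> p)) / (y - \<rho> p) \<le> p" if "y \<in> {0<..<\<rho> p}" for y
    using rho_argmax[of p] that by (auto simp: divide_simps algebra_simps)
qed (use rho_argmax[of p] in auto)

lemma m_rho_ge:
  assumes "\<rho> p < 1"
  shows "p \<le> m (\<rho> p)"
proof (rule DERIV_within_ge[OF f_deriv])
  show "\<rho> p islimpt {\<rho> p<..<1}" using assms by (rule islimpt_greaterThanLessThan_ends)
  show "p \<le> (f y - f (\<rho> p)) / (y - \<rho> p)" if "y \<in> {\<rho> p<..<1}" for y
    using rho_argmax[of p] that by (auto simp: divide_simps algebra_simps)
qed (use rho_argmax[of p] in auto)

text \<open>Together with its mirror image this makes \<rho> a generalized inverse of the marginal
  cost.\<close>

lemma le_rhoI:
  assumes "a \<in> {0..1}" "m a \<le> q"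
  shows "a \<le> \<rho> q"
  using m_strict_mono[of "\<rho> q" a] m_rho_ge[of q] rho_argmax[of q] assms by force

lemma rho_leI:
  assumes "b \<in> {0..1}" "q \<le> m b"
  shows "\<rho> q \<le> b"
  using m_strict_mono[of b "\<rho> q"] m_rho_le[of q] rho_argmax[of q] assms by force

lemma rho_mono: "p \<le> q \<Longrightarrow> \<rho> p \<le> \<rho> q"
  using le_rhoI[of "\<rho> p" q] m_rho_le[of p] rho_argmax[of p] rho_argmax[of q]
  by (cases "\<rho> p = 0") auto

lemma rho_pos: "m 0 < p \<Longrightarrow> 0 < \<rho> p"
  using m_rho_ge[of p] rho_nonneg[of p] by (cases "\<rho> p = 0") auto

lemma rho_pl_pos: "0 < \<rho> pl" and rho_pu_pos: "0 < \<rho> pu"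
  using rho_pos m0_less_pl pl_le_pu by auto

text \<open>A point \<open>c\<close> strictly between the bound and \<open>\<rho> p\<close> has
  marginal cost strictly on one side of \<open>p\<close>. This is an open condition on the price,
  and it keeps \<open>\<rho> q\<close> on the same side of \<open>c\<close>.\<close>

lemma rho_continuous: "isCont \<rho> p"
  unfolding isCont_def
proof (rule order_tendstoI)
  fix a assume a: "a < \<rho> p"
  show "\<forall>\<^sub>F q in at p. a < \<rho> q"
  proof (cases "a < 0")
    case True
    then show ?thesis using rho_nonneg by (auto intro!: always_eventually less_le_trans[OF True])
  next
    case False
    define c where "c = (a + \<rho> p) / 2"
    have c: "a < c" "c < \<rho> p" "c \<in> {0..1}" using a False rho_le_1[of p] by (auto simp: c_def)
    have "m c < p" using m_strict_mono[of c "\<rho> p"] m_rho_le[of p] c rho_argmax[of p] by auto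
    then have "\<forall>\<^sub>F q in at p. m c < q"
      using order_tendstoD(1)[OF tendsto_ident_at] by blast
    then show ?thesis
    proof eventually_elim
      case (elim q)
      then show ?case using c(1) le_rhoI[OF c(3), of q] by simp
    qed
  qed
next
  fix b assume b: "\<rho> p < b"
  show "\<forall>\<^sub>F q in at p. \<rho> q < b"
  proof (cases "1 < b")
    case True
    then show ?thesis using rho_le_1 by (auto intro!: always_eventually le_less_trans[OF _ True])
  next
    case False
    define c where "c = (b + \<rho> p) / 2"
    have c: "c < b" "\<rho> p < c" "c \<in> {0..1}" using b False rho_nonneg[of p] by (auto simp: c_def)
    have "p < m c" using m_strict_mono[of "\<rho> p" c] m_rho_ge[of p] c rho_argmax[of p] by auto
    then have "\<forall>\<^sub>F q in at p. q < m c"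
      using order_tendstoD(2)[OF tendsto_ident_at] by blast
    then show ?thesis
    proof eventually_elim
      case (elim q)
      then show ?case using c(1) rho_leI[OF c(3), of q] by simp
    qed
  qed
qed

text \<open>Envelope argument: the subgradient inequalities at \<open>p\<close> and at
  \<open>q\<close> enclose the difference quotient between \<open>\<rho> p\<close> and
  \<open>\<rho> q\<close>, and \<rho> is continuous.\<close>

lemma H_deriv: "(H has_real_derivative \<rho> p) (at p)"
  unfolding has_field_derivative_iff
proof (rule Lim_transform2[where f = "\<lambda>_. \<rho> p"])
  have "(\<rho> \<longlongrightarrow> \<rho> p) (at p)" using rho_continuous by (simp add: isCont_def)
  then have lim: "((\<lambda>q. \<bar>\<rho> q - \<rho> p\<bar>) \<longlongrightarrow> 0) (at p)"
    by (intro tendsto_rabs_zero LIM_zero)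
  have "\<bar>\<rho> p - (H q - H p) / (q - p)\<bar> \<le> \<bar>\<rho> q - \<rho> p\<bar>" if "q \<noteq> p" for q
  proof -
    have "\<rho> p * (q - p) \<le> H q - H p" "H q - H p \<le> \<rho> q * (q - p)"
      using H_subgradient[of p q] H_subgradient[of q p] by (auto simp: algebra_simps)
    then have le: "\<bar>\<rho> p * (q - p) - (H q - H p)\<bar> \<le> \<bar>(\<rho> q - \<rho> p) * (q - p)\<bar>"
      unfolding left_diff_distrib by linarith
    have "\<rho> p - (H q - H p) / (q - p) = (\<rho> p * (q - p) - (H q - H p)) / (q - p)"
      using that by (simp add: diff_divide_distrib)
    then have "\<bar>\<rho> p - (H q - H p) / (q - p)\<bar> = \<bar>\<rho> p * (q - p) - (H q - H p)\<bar> / \<bar>q - p\<bar>"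
      by (simp only: abs_divide)
    also have "\<dots> \<le> \<bar>(\<rho> q - \<rho> p) * (q - p)\<bar> / \<bar>q - p\<bar>"
      by (rule divide_right_mono[OF le]) simp
    also have "\<dots> = \<bar>\<rho> q - \<rho> p\<bar>"
      using that by (simp only: abs_mult) simp
    finally show ?thesis .
  qed
  then have "\<forall>\<^sub>F q in at p. norm (\<rho> p - (H q - H p) / (q - p)) \<le> \<bar>\<rho> q - \<rho> p\<bar>"
    unfolding eventually_at_filter real_norm_def by (intro always_eventually) blast
  from this lim show "((\<lambda>q. \<rho> p - (H q - H p) / (q - p)) \<longlongrightarrow> 0) (at p)"
    by (rule Lim_null_comparison)
qed (rule tendsto_const)

lemma H_lipschitz: "p \<le> q \<Longrightarrow> H q - H p \<le> q - p"
  using H_subgradient[of q p] mult_left_mono[OF rho_le_1[of q], of "q - p"]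
  by (simp add: algebra_simps)

text \<open>The slope of \<open>H\<close> is \<rho>, which is increasing, so
  \<open>\<rho> pl\<close> bounds it from below. This makes the inverse of \<open>H\<close>
  Lipschitz and turns gaps in \<open>H\<close> into gaps in price.\<close>

lemma H_growth:
  assumes "pl \<le> p" "p \<le> q"
  shows "\<rho> pl * (q - p) \<le> H q - H p"
  using H_subgradient[of p q] mult_right_mono[OF rho_mono[OF assms(1)], of "q - p"] assms(2)
  by (simp add: algebra_simps)

lemma H_strict_mono: "pl \<le> p \<Longrightarrow> p < q \<Longrightarrow> H p < H q"
  using H_growth[of p q] rho_pl_pos by (smt (verit) mult_pos_pos)

lemma H_le_iff: "pl \<le> p \<Longrightarrow> pl \<le> q \<Longrightarrow> H p \<le> H q \<longleftrightarrow> p \<le> q"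
  using H_strict_mono[of p q] H_strict_mono[of q p] by (cases p q rule: linorder_cases) auto

lemma H_inj: "pl \<le> p \<Longrightarrow> pl \<le> q \<Longrightarrow> H p = H q \<longleftrightarrow> p = q"
  using H_le_iff by (metis order_antisym order_refl)

lemma H_continuous: "continuous_on S H"
  using H_deriv by (meson DERIV_isCont continuous_at_imp_continuous_on)

lemma H_pl_pos: "0 < H pl"
proof -
  have "f (\<rho> pl) < m (\<rho> pl) * \<rho> pl"
    using tangent_strict[of "\<rho> pl" 0] rho_argmax[of pl] rho_pl_pos by auto
  also have "\<dots> \<le> pl * \<rho> pl"
    using m_rho_le[OF rho_pl_pos] rho_pl_pos by (intro mult_right_mono) auto
  finally have "f (\<rho> pl) < pl * \<rho> pl" .
  then show ?thesis by (simp add: H_eq)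
qed

lemma H_pl_le: "pl \<le> p \<Longrightarrow> H pl \<le> H p"
  using H_le_iff by simp

text \<open>The inverse of \<open>H\<close>, with its argument clamped to the range between
  \<open>H pl\<close> and \<open>H pu\<close>. Clamping makes it total, bounded, monotone and
  Lipschitz, as the existence theorem and the shooting argument require.\<close>

definition price_of :: "real \<Rightarrow> real" where
  "price_of u = (THE p. p \<in> {pl..pu} \<and> H p = max (H pl) (min (H pu) u))"

lemma price_of_works:
  "price_of u \<in> {pl..pu} \<and> H (price_of u) = max (H pl) (min (H pu) u)"
  unfolding price_of_def
proof (rule theI')
  have "H pl \<le> max (H pl) (min (H pu) u)" "max (H pl) (min (H pu) u) \<le> H pu"
    using H_pl_le[OF pl_le_pu] by auto
  then obtain p where "pl \<le> p" "p \<le> pu" "H p = max (H pl) (min (H pu) u)"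
    using IVT'[of H pl _ pu] pl_le_pu H_continuous by blast
  then show "\<exists>!p. p \<in> {pl..pu} \<and> H p = max (H pl) (min (H pu) u)"
    using H_inj by (metis atLeastAtMost_iff)
qed

lemma price_of_range: "pl \<le> price_of u" "price_of u \<le> pu"
  and H_price_of: "H (price_of u) = max (H pl) (min (H pu) u)"
  using price_of_works by auto

lemma price_of_H: "pl \<le> p \<Longrightarrow> p \<le> pu \<Longrightarrow> price_of (H p) = p"
  using H_price_of[of "H p"] price_of_range[of "H p"] H_pl_le[of p] H_le_iff[of p pu] pl_le_pu
  by (simp add: H_inj)

lemma price_of_mono: "u \<le> v \<Longrightarrow> price_of u \<le> price_of v"
  using H_le_iff[of "price_of u" "price_of v"] by (auto simp: price_of_range H_price_of)

lemma price_of_low: "u \<le> H pl \<Longrightarrow> price_of u = pl"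
  using H_price_of[of u] price_of_range(1)[of u] H_inj[of "price_of u" pl] H_pl_le[OF pl_le_pu]
  by simp

lemma price_of_high: "H pu \<le> u \<Longrightarrow> price_of u = pu"
  using H_price_of[of u] price_of_range(1)[of u] H_inj[of "price_of u" pu] H_pl_le[OF pl_le_pu]
    pl_le_pu by simp

lemma price_of_lipschitz:
  assumes "u \<le> v"
  shows "price_of v - price_of u \<le> (v - u) / \<rho> pl"
proof -
  have "\<rho> pl * (price_of v - price_of u) \<le> H (price_of v) - H (price_of u)"
    by (intro H_growth price_of_range price_of_mono assms)
  also have "\<dots> \<le> v - u"
    unfolding H_price_of using assms by (auto simp: max_def min_def)
  finally show ?thesis using rho_pl_pos by (simp add: field_simps)
qed

lemma price_of_continuous: "continuous_on S price_of"
proof (rule lipschitz_on_continuous_on[of "1 / \<rho> pl"], rule lipschitz_onI)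
  fix u v :: real
  show "dist (price_of u) (price_of v) \<le> 1 / \<rho> pl * dist u v"
    using price_of_lipschitz[of u v] price_of_lipschitz[of v u] price_of_mono[of u v]
      price_of_mono[of v u]
    by (cases "u \<le> v") (auto simp: dist_real_def)
qed (use rho_pl_pos in simp)

text \<open>Strict bounds on \<open>p\<close> keep away from the two kinks where the clamp sets
  in.\<close>

lemma price_of_deriv:
  assumes "pl < p" "p < pu"
  shows "(price_of has_real_derivative inverse (\<rho> p)) (at (H p))"
proof (rule DERIV_inverse_function)
  show "(H has_real_derivative \<rho> p) (at (price_of (H p)))"
    using H_deriv[of p] price_of_H[of p] assms by simp
  show "\<rho> p \<noteq> 0" using rho_pl_pos rho_mono[of pl p] assms by simp
  show "H pl < H p" "H p < H pu" using assms H_strict_mono by auto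
  show "H (price_of u) = u" if "H pl < u" "u < H pu" for u
    using that H_price_of[of u] by simp
  show "isCont price_of (H p)"
    using price_of_continuous[of UNIV] by (simp add: continuous_on_eq_continuous_at)
qed

end

subsection \<open>The pricing equation\<close>

text \<open>Freezing the cost at \<open>\<rho> pu\<close> keeps the price at \<open>pu\<close> from there on.\<close>

locale market_ode = market +
  fixes \<alpha> :: real and \<Psi> :: "real \<Rightarrow> real"
  assumes alpha_nonneg: "0 \<le> \<alpha>"
    and Psi_0: "\<Psi> 0 = 0"
    and Psi_ode: "\<And>y. y \<in> {0..1} \<Longrightarrow>
      (\<Psi> has_real_derivative price_of (\<alpha> * (\<Psi> y - f (min y (\<rho> pu))))) (at y within {0..1})"
begin

definition \<phi> :: "real \<Rightarrow> real" where
  "\<phi> y = price_of (\<alpha> * (\<Psi> y - f (min y (\<rho> pu))))"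

text \<open>Revenue net of production cost; \<alpha> times this is the quantity to be matched with
  \<open>H\<close> of the price.\<close>

definition w :: "real \<Rightarrow> real" where
  "w y = \<Psi> y - f y"

lemma Psi_deriv: "y \<in> {0..1} \<Longrightarrow> (\<Psi> has_real_derivative \<phi> y) (at y within {0..1})"
  using Psi_ode by (simp add: \<phi>_def)

lemma Psi_deriv_at: "0 < y \<Longrightarrow> y < 1 \<Longrightarrow> (\<Psi> has_real_derivative \<phi> y) (at y)"
  using Psi_deriv[of y] by (simp add: at_within_Icc_at)

lemma Psi_continuous: "continuous_on {0..1} \<Psi>"
  using Psi_deriv by (rule DERIV_continuous_on)

lemma w_continuous: "continuous_on {0..1} w"
  unfolding w_def by (intro continuous_intros Psi_continuous f_continuous)

lemma phi_range: "pl \<le> \<phi> y" "\<phi> y \<le> pu"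
  by (simp_all add: \<phi>_def price_of_range)

lemma phi_eq_w: "y \<le> \<rho> pu \<Longrightarrow> \<phi> y = price_of (\<alpha> * w y)"
  by (simp add: \<phi>_def w_def min_absorb1)

lemma w_deriv_at: "0 < y \<Longrightarrow> y < 1 \<Longrightarrow> (w has_real_derivative \<phi> y - m y) (at y)"
  unfolding w_def using Psi_deriv_at f_deriv_at by (intro DERIV_diff) auto

lemma Psi_increments:
  assumes "0 \<le> a" "a \<le> b" "b \<le> 1"
  shows "pl * (b - a) \<le> \<Psi> b - \<Psi> a" "\<Psi> b - \<Psi> a \<le> pu * (b - a)"
proof -
  have "continuous_on {a..b} \<Psi>"
    using assms by (intro continuous_on_subset[OF Psi_continuous]) auto
  then show "pl * (b - a) \<le> \<Psi> b - \<Psi> a" "\<Psi> b - \<Psi> a \<le> pu * (b - a)"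
    using assms phi_range
    by (auto intro!: increment_ge[where g' = \<phi>] increment_le[where g' = \<phi>] Psi_deriv_at)
qed

lemma w_bound:
  assumes "y \<in> {0..1}"
  shows "\<bar>w y\<bar> \<le> pu + f 1"
proof -
  have "0 \<le> pl * y" "pu * y \<le> pu" "0 \<le> f y" "f y \<le> f 1"
    using assms pl_pos pl_le_pu f_mono[of 0 y] f_mono[of y 1] mult_left_mono[of y 1 pu] by auto
  then show ?thesis
    using Psi_increments[of 0 y] Psi_0 assms by (simp add: w_def)
qed

lemma price_gap:
  assumes "x \<le> y"
  shows "price_of (\<alpha> * y) - price_of (\<alpha> * x) \<le> \<alpha> / \<rho> pl * (y - x)"
  using price_of_lipschitz[of "\<alpha> * x" "\<alpha> * y"] assms alpha_nonneg
  by (simp add: mult_left_mono algebra_simps)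

text \<open>If \<open>w\<close> fell below \<open>w y0\<close>, the price would still be within a
  multiple of the deficit of \<open>pu\<close>, while marginal cost before \<open>\<rho> pu\<close>
  is at most \<open>pu\<close>. So the deficit obeys a Gronwall inequality and cannot start. This
  shows that a large \<alpha> overshoots the target.\<close>

lemma w_ge_peak:
  assumes "y0 \<in> {0..\<rho> pu}" "H pu \<le> \<alpha> * w y0"
  shows "w y0 \<le> w (\<rho> pu)"
proof -
  have "0 \<le> w (\<rho> pu) - w y0"
  proof (rule nonneg_by_gronwall[where a = y0 and D = "\<lambda>t. w t - w y0" and K = "\<alpha> / \<rho> pl"])
    fix t assume t: "y0 < t" "t < \<rho> pu" "w t - w y0 < 0"
    have t1: "0 < t" "t < 1" using t assms rho_le_1[of pu] by auto
    have "m t \<le> m (\<rho> pu)" using t t1 rho_argmax[of pu] by (intro m_mono) auto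
    then have "m t \<le> pu" using m_rho_le[OF rho_pu_pos] by simp
    moreover have "price_of (\<alpha> * w y0) = pu" using assms by (intro price_of_high)
    ultimately have "\<alpha> / \<rho> pl * (w t - w y0) \<le> \<phi> t - m t"
      using price_gap[of "w t" "w y0"] t by (simp add: phi_eq_w algebra_simps)
    moreover have "((\<lambda>t. w t - w y0) has_real_derivative \<phi> t - m t) (at t)"
      using w_deriv_at[OF t1] by (auto intro!: derivative_eq_intros)
    ultimately show "\<exists>D'. ((\<lambda>t. w t - w y0) has_real_derivative D') (at t)
        \<and> \<alpha> / \<rho> pl * (w t - w y0) \<le> D'" by blast
  qed (use assms rho_le_1[of pu] in \<open>auto intro!: continuous_intros
        intro: continuous_on_subset[OF w_continuous]\<close>)
  then show ?thesis by simp
qed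

text \<open>Below the marginal cost curve \<open>w\<close> decreases, so the curve is never crossed again.\<close>

lemma w_le_after_crossing:
  assumes "y0 \<in> {0..\<rho> pu}" "\<phi> y0 \<le> m y0"
  shows "w (\<rho> pu) \<le> w y0"
proof -
  have "0 \<le> w y0 - w (\<rho> pu)"
  proof (rule nonneg_by_gronwall[where a = y0 and D = "\<lambda>t. w y0 - w t" and K = "\<alpha> / \<rho> pl"])
    fix t assume t: "y0 < t" "t < \<rho> pu" "w y0 - w t < 0"
    have t1: "0 < t" "t < 1" using t assms rho_le_1[of pu] by auto
    have "m y0 \<le> m t" using t t1 assms by (intro m_mono) auto
    then have "\<alpha> / \<rho> pl * (w y0 - w t) \<le> m t - \<phi> t"
      using price_gap[of "w y0" "w t"] t assms by (simp add: phi_eq_w algebra_simps)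
    moreover have "((\<lambda>t. w y0 - w t) has_real_derivative m t - \<phi> t) (at t)"
      using w_deriv_at[OF t1] by (auto intro!: derivative_eq_intros)
    ultimately show "\<exists>D'. ((\<lambda>t. w y0 - w t) has_real_derivative D') (at t)
        \<and> \<alpha> / \<rho> pl * (w y0 - w t) \<le> D'" by blast
  qed (use assms rho_le_1[of pu] in \<open>auto intro!: continuous_intros
        intro: continuous_on_subset[OF w_continuous]\<close>)
  then show ?thesis by simp
qed

end

section \<open>Dependence on the ratio and choice of the ratio\<close>

context market
begin

lemma market_ode_exists:
  assumes "0 \<le> \<alpha>"
  shows "\<exists>\<Psi>. market_ode f pl pu \<alpha> \<Psi>"
proof -
  let ?F = "\<lambda>t x. price_of (\<alpha> * (x - f (min t (\<rho> pu))))"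
  have "continuous_on ({0..1} \<times> UNIV) (\<lambda>(t, x). ?F t x)"
    unfolding case_prod_unfold
    by (intro continuous_on_compose2[OF price_of_continuous[of UNIV]] continuous_intros
          continuous_on_compose2[OF f_continuous])
       (use rho_argmax[of pu] in auto)
  moreover have "?F t x \<le> ?F t y" if "x \<le> y" for t x y
    using that assms by (intro price_of_mono mult_left_mono) auto
  ultimately have "\<exists>\<Psi>. \<Psi> 0 = 0 \<and>
      (\<forall>t\<in>{0..1}. (\<Psi> has_real_derivative ?F t (\<Psi> t)) (at t within {0..1}))"
    by (intro monotone_ode_exists[where c = pl and d = pu]) (auto simp: price_of_range)
  then obtain \<Psi> where "\<Psi> 0 = 0"
    "\<forall>t\<in>{0..1}. (\<Psi> has_real_derivative ?F t (\<Psi> t)) (at t within {0..1})"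
    by blast
  then have "market_ode f pl pu \<alpha> \<Psi>"
    using assms by unfold_locales auto
  then show ?thesis by blast
qed

text \<open>\<open>L\<close> bounds the sensitivity of the price to the revenue and \<open>C\<close>
  its sensitivity to the parameter. A one-sided estimate is enough, since the two solutions can be
  exchanged.\<close>

lemma market_ode_parameter:
  assumes "market_ode f pl pu \<alpha> \<Psi>" "market_ode f pl pu \<beta> \<Psi>'"
    and "\<beta> \<le> A" "L = A / \<rho> pl" "C = (pu + f 1) / \<rho> pl"
  shows "\<Psi>' (\<rho> pu) - \<Psi> (\<rho> pu) \<le> C * \<bar>\<beta> - \<alpha>\<bar> * exp (L + 1)"
proof -
  interpret a: market_ode f pl pu \<alpha> \<Psi> by fact
  interpret b: market_ode f pl pu \<beta> \<Psi>' by fact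
  define \<delta> where "\<delta> = \<bar>\<beta> - \<alpha>\<bar>"
  have "0 \<le> f 1" using f_mono[of 0 1] by simp
  then have C: "0 \<le> C" using assms(5) rho_pl_pos pl_pos pl_le_pu by simp
  have L: "0 \<le> L" "\<beta> / \<rho> pl \<le> L" using assms b.alpha_nonneg rho_pl_pos
    by (auto simp: divide_right_mono)
  \<comment> \<open>The barrier has exponent \<open>L + 1\<close> rather than \<open>L\<close>: the
    surplus growth absorbs the inhomogeneous term \<open>C * \<delta>\<close>, which is at most the
    barrier itself.\<close>
  define D where "D t = C * \<delta> * exp ((L + 1) * t) - (\<Psi>' t - \<Psi> t)" for t
  have "0 \<le> D (\<rho> pu)"
  proof (rule nonneg_by_gronwall[where a = 0 and D = D and K = L])
    fix t assume t: "0 < t" "t < \<rho> pu" "D t < 0"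
    have t1: "t < 1" using t rho_le_1[of pu] by auto
    let ?e = "C * \<delta> * exp ((L + 1) * t)"
    have "0 \<le> C * \<delta>" using C by (simp add: \<delta>_def)
    moreover have "1 \<le> exp ((L + 1) * t)" using L t by simp
    ultimately have e: "C * \<delta> \<le> ?e" using mult_left_mono[of 1 _ "C * \<delta>"] by simp
    have "0 \<le> C * \<delta>" using C by (simp add: \<delta>_def)
    then have pos: "0 < \<Psi>' t - \<Psi> t" using t e by (simp add: D_def)
    have "b.\<phi> t - a.\<phi> t \<le> L * (\<Psi>' t - \<Psi> t) + C * \<delta>"
    proof (cases "\<beta> * b.w t \<le> \<alpha> * a.w t")
      case True
      then have "b.\<phi> t \<le> a.\<phi> t" using t by (simp add: a.phi_eq_w b.phi_eq_w price_of_mono)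
      moreover have "0 \<le> L * (\<Psi>' t - \<Psi> t)" using L pos by simp
      ultimately show ?thesis using \<open>0 \<le> C * \<delta>\<close> by linarith
    next
      case False
      have "b.\<phi> t - a.\<phi> t \<le> (\<beta> * b.w t - \<alpha> * a.w t) / \<rho> pl"
        using price_of_lipschitz[of "\<alpha> * a.w t" "\<beta> * b.w t"] False t
        by (simp add: a.phi_eq_w b.phi_eq_w)
      moreover have "\<beta> * b.w t - \<alpha> * a.w t = \<beta> * (\<Psi>' t - \<Psi> t) + (\<beta> - \<alpha>) * a.w t"
        by (simp add: a.w_def b.w_def algebra_simps)
      ultimately have "b.\<phi> t - a.\<phi> t \<le>
          \<beta> / \<rho> pl * (\<Psi>' t - \<Psi> t) + (\<beta> - \<alpha>) * a.w t / \<rho> pl"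
        by (simp add: add_divide_distrib)
      moreover have "\<beta> / \<rho> pl * (\<Psi>' t - \<Psi> t) \<le> L * (\<Psi>' t - \<Psi> t)"
        using L pos by (intro mult_right_mono) auto
      moreover have "(\<beta> - \<alpha>) * a.w t / \<rho> pl \<le> C * \<delta>"
      proof -
        have "(\<beta> - \<alpha>) * a.w t \<le> \<bar>\<beta> - \<alpha>\<bar> * \<bar>a.w t\<bar>"
          by (metis abs_ge_self abs_mult)
        also have "\<dots> \<le> \<delta> * (pu + f 1)"
          unfolding \<delta>_def using a.w_bound[of t] t t1 by (intro mult_left_mono) auto
        finally have "(\<beta> - \<alpha>) * a.w t / \<rho> pl \<le> \<delta> * (pu + f 1) / \<rho> pl"
          using rho_nonneg by (rule divide_right_mono)
        then show ?thesis by (simp add: assms(5) mult.commute)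
      qed
      ultimately show ?thesis by linarith
    qed
    then have "L * D t \<le> (L + 1) * ?e - (b.\<phi> t - a.\<phi> t)"
      using e by (simp add: D_def distrib_right right_diff_distrib mult.assoc)
    moreover have "(D has_real_derivative (L + 1) * ?e - (b.\<phi> t - a.\<phi> t)) (at t)"
      unfolding D_def using t t1
      by (auto intro!: derivative_eq_intros a.Psi_deriv_at b.Psi_deriv_at)
    ultimately show "\<exists>D'. (D has_real_derivative D') (at t) \<and> L * D t \<le> D'" by blast
  next
    show "continuous_on {0..\<rho> pu} D"
      unfolding D_def using rho_le_1[of pu]
      by (intro continuous_intros continuous_on_subset[OF a.Psi_continuous]
            continuous_on_subset[OF b.Psi_continuous]) auto
    show "0 \<le> D 0" using C by (simp add: D_def \<delta>_def a.Psi_0 b.Psi_0)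
  qed (rule rho_nonneg)
  then have "\<Psi>' (\<rho> pu) - \<Psi> (\<rho> pu) \<le> C * \<delta> * exp ((L + 1) * \<rho> pu)" by (simp add: D_def)
  also have "\<dots> \<le> C * \<delta> * exp (L + 1)"
    using C L rho_nonneg[of pu] rho_le_1[of pu]
    by (intro mult_left_mono) (auto simp: \<delta>_def mult_left_le)
  finally show ?thesis by (simp add: \<delta>_def)
qed

text \<open>Intermediate value theorem in \<alpha>. At 1 the target is not exceeded because no price
  is above \<open>pu\<close>; at the upper end it is reached because no price is below
  \<open>pl\<close>.\<close>

lemma market_ode_peak_exists:
  "\<exists>\<alpha> \<Psi>. 1 \<le> \<alpha> \<and> market_ode f pl pu \<alpha> \<Psi> \<and> \<alpha> * (\<Psi> (\<rho> pu) - f (\<rho> pu)) = H pu"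
proof -
  \<comment> \<open>Selling \<open>\<rho> pl\<close> units at the lowest price already earns net
    revenue \<open>H pl\<close>, and this factor lifts it to \<open>H pu\<close>.\<close>
  define A where "A = H pu / H pl"
  have A: "1 \<le> A" using H_pl_pos H_pl_le[OF pl_le_pu] by (simp add: A_def)
  obtain S where S: "\<And>\<alpha>. 0 \<le> \<alpha> \<Longrightarrow> market_ode f pl pu \<alpha> (S \<alpha>)"
    using market_ode_exists by metis
  define K where "K = (pu + f 1) / \<rho> pl * exp (A / \<rho> pl + 1)"
  have "0 \<le> f 1" using f_mono[of 0 1] by simp
  then have K: "0 \<le> K" using rho_pl_pos pl_pos pl_le_pu by (simp add: K_def)
  have lip: "S \<beta> (\<rho> pu) - S \<alpha> (\<rho> pu) \<le> K * \<bar>\<beta> - \<alpha>\<bar>" if "\<alpha> \<in> {1..A}" "\<beta> \<in> {1..A}" for \<alpha> \<beta>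
    using market_ode_parameter[OF S S, of \<alpha> \<beta> A] that by (simp add: K_def mult_ac)
  have "continuous_on {1..A} (\<lambda>\<alpha>. S \<alpha> (\<rho> pu))"
  proof (rule lipschitz_on_continuous_on, rule lipschitz_onI[OF _ K])
    show "dist (S \<alpha> (\<rho> pu)) (S \<beta> (\<rho> pu)) \<le> K * dist \<alpha> \<beta>"
      if "\<alpha> \<in> {1..A}" "\<beta> \<in> {1..A}" for \<alpha> \<beta>
      using lip[OF that] lip[OF that(2,1)] by (simp add: dist_real_def abs_le_iff abs_minus_commute)
  qed
  then have cont: "continuous_on {1..A} (\<lambda>\<alpha>. \<alpha> * (S \<alpha> (\<rho> pu) - f (\<rho> pu)))"
    by (intro continuous_intros)
  interpret s1: market_ode f pl pu 1 "S 1" by (rule S) simp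
  interpret sA: market_ode f pl pu A "S A" using S A by simp
  have "1 * (S 1 (\<rho> pu) - f (\<rho> pu)) \<le> H pu"
    using s1.Psi_increments(2)[of 0 "\<rho> pu"] s1.Psi_0 rho_nonneg rho_le_1 by (simp add: H_eq)
  moreover have "H pu \<le> A * (S A (\<rho> pu) - f (\<rho> pu))"
  proof -
    have "H pl \<le> sA.w (\<rho> pl)"
      using sA.Psi_increments(1)[of 0 "\<rho> pl"] sA.Psi_0 rho_nonneg rho_le_1
      by (simp add: H_eq sA.w_def)
    then have "A * H pl \<le> A * sA.w (\<rho> pl)"
      using A by (intro mult_left_mono) auto
    then have *: "H pu \<le> A * sA.w (\<rho> pl)"
      using H_pl_pos by (simp add: A_def)
    then have "sA.w (\<rho> pl) \<le> sA.w (\<rho> pu)"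
      using rho_mono[OF pl_le_pu] rho_nonneg by (intro sA.w_ge_peak) auto
    then have "A * sA.w (\<rho> pl) \<le> A * sA.w (\<rho> pu)"
      using A by (intro mult_left_mono) auto
    then show ?thesis using * by (simp add: sA.w_def)
  qed
  ultimately obtain \<alpha> where "1 \<le> \<alpha>" "\<alpha> \<le> A" "\<alpha> * (S \<alpha> (\<rho> pu) - f (\<rho> pu)) = H pu"
    using IVT'[of "\<lambda>\<alpha>. \<alpha> * (S \<alpha> (\<rho> pu) - f (\<rho> pu))" 1 "H pu" A] A cont by blast
  then show ?thesis using S[of \<alpha>] by (intro exI[of _ \<alpha>] exI[of _ "S \<alpha>"]) auto
qed

end

section \<open>Shape of the optimal price\<close>

locale optimal_ode = market_ode +
  assumes alpha_ge_1: "1 \<le> \<alpha>" and peak: "\<alpha> * w (\<rho> pu) = H pu"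
begin

text \<open>Had the price met marginal cost at \<open>y\<close>, net revenue could not rise above
  \<open>w y\<close> up to the peak, so \<open>\<alpha> * w y\<close> would already be at least
  \<open>H pu\<close> and the price equal to \<open>pu\<close>. But marginal cost at
  \<open>y\<close> is strictly below that at \<open>\<rho> pu\<close>, hence below
  \<open>pu\<close>.\<close>

lemma m_less_phi:
  assumes "0 \<le> y" "y < \<rho> pu"
  shows "m y < \<phi> y"
proof (rule ccontr)
  assume "\<not> m y < \<phi> y"
  then have "w (\<rho> pu) \<le> w y" using assms by (intro w_le_after_crossing) auto
  then have "\<alpha> * w (\<rho> pu) \<le> \<alpha> * w y" using alpha_nonneg by (rule mult_left_mono)
  then have "\<phi> y = pu" using assms peak by (simp add: phi_eq_w price_of_high)
  moreover have "m y < m (\<rho> pu)" using assms rho_argmax[of pu] by (intro m_strict_mono) auto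
  ultimately show False using \<open>\<not> m y < \<phi> y\<close> m_rho_le[OF rho_pu_pos] by simp
qed

lemma w_strict_mono:
  assumes "0 \<le> a" "a < b" "b \<le> \<rho> pu"
  shows "w a < w b"
proof (rule DERIV_pos_imp_increasing_open[of a b w])
  show "\<exists>y. (w has_real_derivative y) (at x) \<and> 0 < y" if "a < x" "x < b" for x
    using w_deriv_at[of x] m_less_phi[of x] that assms rho_le_1[of pu]
    by (intro exI[of _ "\<phi> x - m x"]) auto
  show "continuous_on {a..b} w"
    using assms rho_le_1[of pu] by (intro continuous_on_subset[OF w_continuous]) auto
qed (rule assms)

lemma w_mono: "0 \<le> a \<Longrightarrow> a \<le> b \<Longrightarrow> b \<le> \<rho> pu \<Longrightarrow> w a \<le> w b"
  using w_strict_mono[of a b] by (cases "a = b") auto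

lemma omega_exists: "\<exists>\<omega>. 0 \<le> \<omega> \<and> \<omega> \<le> \<rho> pu \<and> \<alpha> * w \<omega> = H pl"
proof -
  have "continuous_on {0..\<rho> pu} (\<lambda>y. \<alpha> * w y)"
    using rho_le_1[of pu]
    by (intro continuous_intros continuous_on_subset[OF w_continuous]) auto
  then show ?thesis
    using IVT'[of "\<lambda>y. \<alpha> * w y" 0 "H pl" "\<rho> pu"] H_pl_pos H_pl_le[OF pl_le_pu] peak rho_nonneg[of pu]
    by (auto simp: w_def Psi_0)
qed

end

locale optimal_threshold_ode = optimal_ode +
  fixes \<omega> :: real
  assumes omega_nonneg: "0 \<le> \<omega>" and omega_le: "\<omega> \<le> \<rho> pu" and w_omega: "\<alpha> * w \<omega> = H pl"
begin

lemma alpha_pos: "0 < \<alpha>" using alpha_ge_1 by simp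

lemma phi_flat:
  assumes "0 \<le> y" "y \<le> \<omega>"
  shows "\<phi> y = pl"
proof -
  have "\<alpha> * w y \<le> \<alpha> * w \<omega>"
    using assms omega_le alpha_nonneg by (intro mult_left_mono w_mono) auto
  then show ?thesis using assms omega_le w_omega by (simp add: phi_eq_w price_of_low)
qed

lemma H_phi:
  assumes "\<omega> \<le> y" "y \<le> \<rho> pu"
  shows "H (\<phi> y) = \<alpha> * w y"
proof -
  have "\<alpha> * w \<omega> \<le> \<alpha> * w y" "\<alpha> * w y \<le> \<alpha> * w (\<rho> pu)"
    using assms omega_nonneg alpha_nonneg by (auto intro!: mult_left_mono w_mono)
  then show ?thesis using assms w_omega peak by (simp add: phi_eq_w H_price_of)
qed

text \<open>With the cost frozen, the argument of the clamped inverse can only increase past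
  \<open>\<rho> pu\<close>, so it stays in the upper clamp.\<close>

lemma phi_end:
  assumes "\<rho> pu \<le> y" "y \<le> 1"
  shows "\<phi> y = pu"
proof -
  have "0 \<le> pl * (y - \<rho> pu)" using assms pl_pos by simp
  then have "\<Psi> (\<rho> pu) \<le> \<Psi> y"
    using Psi_increments(1)[of "\<rho> pu" y] assms rho_nonneg[of pu] by simp
  then have "\<alpha> * w (\<rho> pu) \<le> \<alpha> * (\<Psi> y - f (\<rho> pu))"
    unfolding w_def using alpha_nonneg by (intro mult_left_mono) auto
  then show ?thesis using assms peak by (simp add: \<phi>_def price_of_high)
qed

lemma phi_strict_mono:
  assumes "\<omega> \<le> a" "a < b" "b \<le> \<rho> pu"
  shows "\<phi> a < \<phi> b"
proof -
  have "\<alpha> * w a < \<alpha> * w b"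
    using assms omega_nonneg alpha_pos by (intro mult_strict_left_mono w_strict_mono) auto
  then have "H (\<phi> a) < H (\<phi> b)" using assms by (simp add: H_phi)
  then show ?thesis using H_le_iff[of "\<phi> b" "\<phi> a"] phi_range by (simp flip: not_le)
qed

lemma phi_mono:
  assumes "0 \<le> a" "a \<le> b" "b \<le> 1"
  shows "\<phi> a \<le> \<phi> b"
proof -
  consider "a \<le> \<omega>" | "\<rho> pu \<le> b" | "a = b" | "\<omega> \<le> a" "a < b" "b \<le> \<rho> pu" using assms by linarith
  then show ?thesis
    by cases (use assms phi_flat phi_end phi_range phi_strict_mono[of a b] in auto)
qed

lemma phi_continuous: "continuous_on {0..1} \<phi>"
  unfolding \<phi>_def
  by (intro continuous_on_compose2[OF price_of_continuous[of UNIV]] continuous_intros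
        continuous_on_compose2[OF f_continuous] Psi_continuous)
     (use rho_argmax[of pu] in auto)

lemma Psi_slope:
  assumes "0 \<le> a" "a \<le> b" "b \<le> 1"
  shows "\<phi> a * (b - a) \<le> \<Psi> b - \<Psi> a" "\<Psi> b - \<Psi> a \<le> \<phi> b * (b - a)"
proof -
  have "continuous_on {a..b} \<Psi>"
    using assms by (intro continuous_on_subset[OF Psi_continuous]) auto
  then show "\<phi> a * (b - a) \<le> \<Psi> b - \<Psi> a" "\<Psi> b - \<Psi> a \<le> \<phi> b * (b - a)"
    using assms
    by (auto intro!: increment_ge[where g' = \<phi>] increment_le[where g' = \<phi>] Psi_deriv_at phi_mono)
qed

lemma Psi_flat: "0 \<le> y \<Longrightarrow> y \<le> \<omega> \<Longrightarrow> \<Psi> y = pl * y"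
  using Psi_slope[of 0 y] phi_flat[of 0] phi_flat[of y] omega_le rho_le_1[of pu] Psi_0 omega_nonneg
  by simp

text \<open>Equality is available only on the increasing segment, but an arbitrary algorithm may end
  at any utilization. Past \<open>\<rho> pu\<close> net revenue cannot grow, because \<rho>
  maximizes profit at price \<open>pu\<close>.\<close>

lemma w_le_H_phi:
  assumes "y \<in> {0..1}"
  shows "\<alpha> * w y \<le> H (\<phi> y)"
proof -
  consider "y \<le> \<omega>" | "\<omega> \<le> y" "y \<le> \<rho> pu" | "\<rho> pu \<le> y" by linarith
  then show ?thesis
  proof cases
    case 1
    then have "\<alpha> * w y \<le> \<alpha> * w \<omega>"
      using assms omega_le alpha_nonneg by (intro mult_left_mono w_mono) auto
    then show ?thesis using 1 assms w_omega by (simp add: phi_flat)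
  next
    case 2
    then show ?thesis by (simp add: H_phi)
  next
    case 3
    have "\<Psi> y - \<Psi> (\<rho> pu) \<le> pu * (y - \<rho> pu)"
      using 3 assms rho_nonneg by (intro Psi_increments) auto
    then have "w y \<le> w (\<rho> pu)"
      using rho_argmax[of pu] assms by (force simp: w_def algebra_simps)
    then have "\<alpha> * w y \<le> \<alpha> * w (\<rho> pu)"
      using alpha_nonneg by (rule mult_left_mono)
    then show ?thesis using 3 assms peak by (simp add: phi_end)
  qed
qed

lemma w_lipschitz:
  assumes "x \<in> {0..1}" "y \<in> {0..1}"
  shows "\<bar>w x - w y\<bar> \<le> (pu + m 1) * \<bar>x - y\<bar>"
proof -
  have *: "\<bar>\<Psi> x - \<Psi> y\<bar> \<le> pu * \<bar>x - y\<bar>" if "x \<in> {0..1}" "y \<in> {0..1}" "x \<le> y" for x y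
  proof -
    have "0 \<le> pl * (y - x)" using that pl_pos by simp
    then show ?thesis using Psi_increments[of x y] that by (simp add: algebra_simps)
  qed
  have "\<bar>\<Psi> x - \<Psi> y\<bar> \<le> pu * \<bar>x - y\<bar>"
    using *[of x y] *[of y x] assms by (cases "x \<le> y") (auto simp: abs_minus_commute)
  then show ?thesis using f_lipschitz[OF assms] by (simp add: w_def algebra_simps)
qed

end

lemma (in market) optimal_threshold_ode_exists:
  "\<exists>\<alpha> \<Psi> \<omega>. optimal_threshold_ode f pl pu \<alpha> \<Psi> \<omega>"
proof -
  obtain \<alpha> \<Psi> where *: "1 \<le> \<alpha>" "market_ode f pl pu \<alpha> \<Psi>" "\<alpha> * (\<Psi> (\<rho> pu) - f (\<rho> pu)) = H pu"
    using market_ode_peak_exists by blast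
  interpret market_ode f pl pu \<alpha> \<Psi> by fact
  interpret optimal_ode f pl pu \<alpha> \<Psi>
    using * by unfold_locales (auto simp: w_def)
  obtain \<omega> where "0 \<le> \<omega>" "\<omega> \<le> \<rho> pu" "\<alpha> * w \<omega> = H pl"
    using omega_exists by blast
  then have "optimal_threshold_ode f pl pu \<alpha> \<Psi> \<omega>"
    by unfold_locales
  then show ?thesis by blast
qed

subsection \<open>Online algorithms and the lower bound\<close>

lemma accepted_snoc:
  "accepted alg (A @ [\<theta>]) = accepted alg A \<union> (if alg (A @ [\<theta>]) then {length A} else {})"
  by (auto simp: accepted_def less_Suc_eq)

lemma accepted_less: "accepted alg A \<subseteq> {..<length A}"
  by (auto simp: accepted_def)

lemma finite_accepted [simp]: "finite (accepted alg A)"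
  using accepted_less finite_lessThan by (rule finite_subset)

text \<open>The summand may depend on the preceding history, so that one recursion serves demand,
  gain and payments at history-dependent prices.\<close>

lemma sum_accepted_snoc:
  fixes g :: "agent list \<Rightarrow> agent \<Rightarrow> real"
  shows "(\<Sum>n\<in>accepted alg (A @ [\<theta>]). g (take n (A @ [\<theta>])) ((A @ [\<theta>]) ! n)) =
    (\<Sum>n\<in>accepted alg A. g (take n A) (A ! n)) + (if alg (A @ [\<theta>]) then g A \<theta> else 0)"
proof -
  have "(\<Sum>n\<in>accepted alg A. g (take n (A @ [\<theta>])) ((A @ [\<theta>]) ! n)) =
      (\<Sum>n\<in>accepted alg A. g (take n A) (A ! n))"
    using accepted_less[of alg A] by (intro sum.cong) (auto simp: nth_append)
  moreover have "length A \<notin> accepted alg A" by (simp add: accepted_def)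
  ultimately show ?thesis by (auto simp: accepted_snoc)
qed

definition used :: "algorithm \<Rightarrow> agent list \<Rightarrow> real" where
  "used alg A = demand A (accepted alg A)"

definition gain :: "algorithm \<Rightarrow> agent list \<Rightarrow> real" where
  "gain alg A = (\<Sum>n\<in>accepted alg A. snd (A ! n))"

lemma online_welfare_eq: "online_welfare f alg A = gain alg A - f (used alg A)"
  by (simp add: online_welfare_def welfare_def gain_def used_def)

lemma used_snoc: "used alg (A @ [\<theta>]) = used alg A + (if alg (A @ [\<theta>]) then fst \<theta> else 0)"
  unfolding used_def demand_def by (rule sum_accepted_snoc)

lemma gain_snoc: "gain alg (A @ [\<theta>]) = gain alg A + (if alg (A @ [\<theta>]) then snd \<theta> else 0)"
  unfolding gain_def by (rule sum_accepted_snoc)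

lemma used_Nil [simp]: "used alg [] = 0" and gain_Nil [simp]: "gain alg [] = 0"
  by (simp_all add: used_def gain_def demand_def accepted_def)

lemma used_append_ge:
  assumes "\<And>\<theta>. \<theta> \<in> set B \<Longrightarrow> 0 < fst \<theta>"
  shows "used alg A \<le> used alg (A @ B)"
  using assms
proof (induction B rule: rev_induct)
  case (snoc \<theta> B)
  then have "used alg A \<le> used alg (A @ B)" "0 < fst \<theta>" by simp_all
  then show ?case using used_snoc[of alg "A @ B" \<theta>] by (auto split: if_splits)
qed simp

lemma used_nonneg: "(\<And>\<theta>. \<theta> \<in> set B \<Longrightarrow> 0 < fst \<theta>) \<Longrightarrow> 0 \<le> used alg B"
  using used_append_ge[of B alg "[]"] by simp

lemma replicate_snoc: "replicate (Suc n) x = replicate n x @ [x]"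
  by (simp add: replicate_append_same)

lemma gain_block:
  "gain alg (A @ replicate n (r, p * r)) - gain alg A
    = p * (used alg (A @ replicate n (r, p * r)) - used alg A)"
proof (induction n)
  case (Suc n)
  then show ?case
    unfolding replicate_snoc
    using gain_snoc[of alg "A @ replicate n (r, p * r)" "(r, p * r)"]
      used_snoc[of alg "A @ replicate n (r, p * r)" "(r, p * r)"]
    by (simp add: algebra_simps del: replicate_Suc)
qed simp

lemma offline_welfare_ge:
  assumes "X \<subseteq> {..<length A}" "demand A X \<le> 1"
  shows "welfare f A X \<le> offline_welfare f A"
  unfolding offline_welfare_def using assms by (intro Max_ge) auto

lemma offline_welfare_le:
  assumes "\<And>X. X \<subseteq> {..<length A} \<Longrightarrow> demand A X \<le> 1 \<Longrightarrow> welfare f A X \<le> c"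
  shows "offline_welfare f A \<le> c"
proof -
  have "{} \<in> {X. X \<subseteq> {..<length A} \<and> demand A X \<le> 1}" by (simp add: demand_def)
  then have "{X. X \<subseteq> {..<length A} \<and> demand A X \<le> 1} \<noteq> {}" by blast
  then show ?thesis
    unfolding offline_welfare_def using assms by (subst Max_le_iff) auto
qed

lemma offline_welfare_nonneg: "f 0 = 0 \<Longrightarrow> 0 \<le> offline_welfare f A"
  using offline_welfare_ge[of "{}" A f] by (simp add: welfare_def demand_def)

lemma offline_welfare_block:
  assumes "k \<le> n" "real k * r \<le> 1"
  shows "p * (real k * r) - f (real k * r) \<le> offline_welfare f (A @ replicate n (r, p * r))"
proof -
  let ?A = "A @ replicate n (r, p * r)"
  let ?X = "{length A..<length A + k}"
  have *: "?A ! i = (r, p * r)" if "i \<in> ?X" for i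
  proof -
    have "i - length A < n" using that assms(1) by auto
    then show ?thesis using that by (simp add: nth_append)
  qed
  have "demand ?A ?X = real k * r" unfolding demand_def using * by simp
  moreover have "(\<Sum>i\<in>?X. snd (?A ! i)) = real k * (p * r)" using * by simp
  ultimately have "welfare f ?A ?X = p * (real k * r) - f (real k * r)"
    unfolding welfare_def by simp
  moreover have "welfare f ?A ?X \<le> offline_welfare f ?A"
    using assms \<open>demand ?A ?X = _\<close> by (intro offline_welfare_ge) auto
  ultimately show ?thesis by simp
qed

lemma instances_valid:
  assumes "A \<in> instances pl pu \<epsilon>" "\<theta> \<in> set A"
  shows "0 < fst \<theta>" "fst \<theta> \<le> \<epsilon>" "pl * fst \<theta> \<le> snd \<theta>" "snd \<theta> \<le> pu * fst \<theta>"
  using assms by (auto simp: instances_def valid_agent_def field_simps)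

lemma online_le_offline:
  assumes "online_algorithm pl pu alg" "A \<in> instances pl pu \<epsilon>"
  shows "online_welfare f alg A \<le> offline_welfare f A"
  unfolding online_welfare_def using assms
  by (intro offline_welfare_ge accepted_less) (auto simp: online_algorithm_def instances_def)

lemma welfare_ratio_leD:
  assumes "welfare_ratio f alg A \<le> ereal c" "f 0 = 0"
  shows "offline_welfare f A \<le> c * online_welfare f alg A"
  using assms offline_welfare_nonneg[of f A]
  by (auto simp: welfare_ratio_def field_simps split: if_splits)

text \<open>If online welfare is not positive, \<open>1 \<le> c\<close> makes the right-hand side at
  most online welfare. The two welfares then coincide and the ratio is 1 by convention.\<close>

lemma welfare_ratio_leI:
  assumes "offline_welfare f A \<le> c * online_welfare f alg A"
    and "online_welfare f alg A \<le> offline_welfare f A" "1 \<le> c"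
  shows "welfare_ratio f alg A \<le> ereal c"
proof (cases "0 < online_welfare f alg A")
  case True
  then show ?thesis using assms by (simp add: welfare_ratio_def field_simps)
next
  case False
  then have "c * online_welfare f alg A \<le> 1 * online_welfare f alg A"
    using assms(3) by (intro mult_right_mono_neg) auto
  then show ?thesis using assms False by (simp add: welfare_ratio_def one_ereal_def)
qed

lemma competitive_ratio_lessD:
  assumes "competitive_ratio f pl pu alg < ereal c" "f 0 = 0"
  shows "\<exists>\<epsilon>>0. \<forall>A\<in>instances pl pu \<epsilon>. offline_welfare f A \<le> c * online_welfare f alg A"
proof -
  obtain \<epsilon> where "0 < \<epsilon>" and *: "(SUP A\<in>instances pl pu \<epsilon>. welfare_ratio f alg A) < ereal c"
    using assms(1) by (auto simp: competitive_ratio_def INF_less_iff)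
  have "welfare_ratio f alg A \<le> ereal c" if "A \<in> instances pl pu \<epsilon>" for A
    using SUP_upper[OF that, of "welfare_ratio f alg"] * by order
  then show ?thesis using \<open>0 < \<epsilon>\<close> welfare_ratio_leD assms(2) by blast
qed

lemma competitive_ratio_leI:
  assumes "online_algorithm pl pu alg" "1 \<le> c"
    and "\<And>\<delta>. 0 < \<delta> \<Longrightarrow> \<exists>\<epsilon>>0. \<forall>A\<in>instances pl pu \<epsilon>.
      offline_welfare f A \<le> (c + \<delta>) * online_welfare f alg A"
  shows "competitive_ratio f pl pu alg \<le> ereal c"
proof (rule ereal_le_epsilon2)
  fix \<delta> :: real assume "0 < \<delta>"
  then obtain \<epsilon> where "0 < \<epsilon>" and
    \<epsilon>: "\<And>A. A \<in> instances pl pu \<epsilon> \<Longrightarrow> offline_welfare f A \<le> (c + \<delta>) * online_welfare f alg A"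
    using assms(3) by blast
  have "competitive_ratio f pl pu alg \<le> (SUP A\<in>instances pl pu \<epsilon>. welfare_ratio f alg A)"
    unfolding competitive_ratio_def using \<open>0 < \<epsilon>\<close> by (intro INF_lower) simp
  also have "\<dots> \<le> ereal (c + \<delta>)"
    using assms(2) \<open>0 < \<delta>\<close>
    by (intro SUP_least welfare_ratio_leI \<epsilon> online_le_offline[OF assms(1)]) auto
  finally show "competitive_ratio f pl pu alg \<le> ereal c + ereal \<delta>" by simp
qed

text \<open>Each block alone is enough to fill the whole capacity.\<close>

primrec staircase :: "nat \<Rightarrow> (nat \<Rightarrow> real) \<Rightarrow> nat \<Rightarrow> agent list" where
  "staircase M q 0 = []"
| "staircase M q (Suc i) = staircase M q i @ replicate M (1 / M, q i * (1 / M))"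

lemma staircase_instance:
  assumes "0 < M" "1 / M \<le> \<epsilon>" "\<And>j. j < i \<Longrightarrow> pl \<le> q j \<and> q j \<le> pu"
  shows "staircase M q i \<in> instances pl pu \<epsilon>"
  using assms by (induction i) (auto simp: instances_def valid_agent_def)

lemma used_staircase_mono:
  assumes "0 < M"
  shows "used alg (staircase M q i) \<le> used alg (staircase M q (Suc i))"
  using assms by (auto intro!: used_append_ge)

context market
begin

lemma offline_staircase:
  assumes "0 < M" "0 \<le> q i" "q i \<le> pu"
  shows "H (q i) - pu / M \<le> offline_welfare f (staircase M q (Suc i))"
proof -
  let ?r = "\<rho> (q i)"
  \<comment> \<open>The ideal amount is rounded down to a whole number of agents; less than one
    agent is lost, worth at most \<open>pu / M\<close>.\<close>
  define k where "k = nat \<lfloor>?r * M\<rfloor>"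
  have "0 \<le> ?r * M" using rho_nonneg by simp
  then have k: "real k \<le> ?r * M" "?r * M < real k + 1"
    unfolding k_def by (auto simp: of_nat_nat)
  have "?r * M \<le> M" using rho_le_1[of "q i"] assms by simp
  then have "k \<le> M" using k by linarith
  let ?x = "real k * (1 / M)"
  have "(?r * M - 1) * (1 / M) \<le> ?x" "?x \<le> ?r * M * (1 / M)"
    using k by (intro mult_right_mono; simp)+
  then have x: "?x \<le> ?r" "?r - 1 / M \<le> ?x" "0 \<le> ?x"
    using assms(1) by (auto simp: diff_divide_distrib)
  have "f ?x \<le> f ?r" using x rho_le_1 by (intro f_mono) auto
  moreover have "q i * (?r - 1 / M) \<le> q i * ?x" using x assms by (intro mult_left_mono) auto
  moreover have "q i / M \<le> pu / M" using assms by (intro divide_right_mono) auto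
  moreover have "q i * ?x - f ?x \<le> offline_welfare f (staircase M q (Suc i))"
    unfolding staircase.simps
    using \<open>k \<le> M\<close> x rho_le_1[of "q i"] by (intro offline_welfare_block) auto
  ultimately show ?thesis by (simp add: H_eq algebra_simps)
qed

lemma used_le_1:
  assumes "online_algorithm pl pu alg" "A \<in> instances pl pu \<epsilon>"
  shows "used alg A \<in> {0..1}"
proof -
  have "0 \<le> used alg A" using instances_valid(1)[OF assms(2)] by (rule used_nonneg)
  then show ?thesis using assms by (auto simp: online_algorithm_def used_def instances_def)
qed

end

context optimal_threshold_ode
begin

text \<open>Competitiveness after a block forces a net revenue whose \<open>H\<close>-price exceeds
  the current density, and even the next one. Each block is therefore sold below the price \<phi>,
  which in turn caps the gain by \<Psi>. The last density \<open>pu\<close> then contradicts the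
  range of \<phi>.\<close>

lemma adversary_beats:
  assumes alg: "online_algorithm pl pu alg" and "0 < c" "c < \<alpha>" "0 < \<epsilon>"
  shows "\<exists>A\<in>instances pl pu \<epsilon>. c * online_welfare f alg A < offline_welfare f A"
proof (rule ccontr)
  assume "\<not> ?thesis"
  then have comp: "offline_welfare f A \<le> c * online_welfare f alg A"
    if "A \<in> instances pl pu \<epsilon>" for A using that by force
  \<comment> \<open>The margin by which ratio \<open>c\<close> beats \<alpha>, taken at the lowest
    density and hence valid at all of them. Half of it pays for the density step (choice of
    \<open>N\<close>), half for the rounding of the offline solution (choice of
    \<open>M\<close>).\<close>
  define \<kappa> where "\<kappa> = (\<alpha> / c - 1) * H pl"
  have \<kappa>: "0 < \<kappa>" using assms H_pl_pos by (simp add: \<kappa>_def)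
  obtain N :: nat where "2 * (pu - pl) / \<kappa> < N" using reals_Archimedean2 by blast
  moreover have "0 \<le> 2 * (pu - pl) / \<kappa>" using \<kappa> pl_le_pu by simp
  ultimately have "0 < real N" by linarith
  then have N: "0 < N" "(pu - pl) / N < \<kappa> / 2"
    using \<open>2 * (pu - pl) / \<kappa> < N\<close> \<kappa> by (auto simp: field_simps)
  obtain M :: nat where M: "max (1 / \<epsilon>) (2 * (\<alpha> / c * pu) / \<kappa>) < M"
    using reals_Archimedean2 by blast
  moreover have "0 < 1 / \<epsilon>" using assms by simp
  ultimately have "0 < real M" by linarith
  then have M: "0 < M" "1 / M \<le> \<epsilon>" "\<alpha> / c * (pu / M) < \<kappa> / 2"
    using M \<kappa> assms by (auto simp: field_simps)
  define q where "q j = pl + (pu - pl) / N * real j" for j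
  have q: "pl \<le> q j" "q j \<le> pu" if "j \<le> N" for j
  proof -
    show "pl \<le> q j" using pl_le_pu by (simp add: q_def)
    have "(pu - pl) / N * real j \<le> (pu - pl) / N * real N"
      using that pl_le_pu by (intro mult_left_mono) auto
    then show "q j \<le> pu" using N by (simp add: q_def)
  qed
  have q_end: "q N = pu" using N by (simp add: q_def)
  define A where "A i = staircase M q i" for i
  define Y where "Y i = used alg (A i)" for i
  have inst: "A i \<in> instances pl pu \<epsilon>" if "i \<le> Suc N" for i
    unfolding A_def using M q that by (intro staircase_instance) auto
  have Y: "Y i \<in> {0..1}" if "i \<le> Suc N" for i
    unfolding Y_def using used_le_1[OF alg inst[OF that]] .
  \<comment> \<open>\<open>H\<close> is 1-Lipschitz, so adding the density step on the left also
    covers the next density.\<close>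
  have price: "H (q i) + (pu - pl) / N < H (\<phi> (Y (Suc i)))"
    if "i \<le> N" "gain alg (A (Suc i)) \<le> \<Psi> (Y (Suc i))" for i
  proof -
    have "H (q i) - pu / M \<le> c * (gain alg (A (Suc i)) - f (Y (Suc i)))"
      using offline_staircase[of M q i] comp[OF inst, of "Suc i"] q[of i] that M pl_pos
      by (simp add: A_def Y_def online_welfare_eq del: staircase.simps)
    also have "\<dots> \<le> c * w (Y (Suc i))"
      using that \<open>0 < c\<close> by (intro mult_left_mono) (auto simp: w_def)
    finally have "\<alpha> / c * (H (q i) - pu / M) \<le> \<alpha> / c * (c * w (Y (Suc i)))"
      using alpha_pos \<open>0 < c\<close> by (intro mult_left_mono) auto
    then have "\<alpha> / c * (H (q i) - pu / M) \<le> \<alpha> * w (Y (Suc i))"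
      using \<open>0 < c\<close> by simp
    also have "\<dots> \<le> H (\<phi> (Y (Suc i)))" using Y that by (intro w_le_H_phi) auto
    finally have "\<alpha> / c * H (q i) - \<alpha> / c * (pu / M) \<le> H (\<phi> (Y (Suc i)))"
      by (simp add: right_diff_distrib)
    moreover have "\<kappa> \<le> (\<alpha> / c - 1) * H (q i)"
      unfolding \<kappa>_def using assms q[OF that(1)] by (intro mult_left_mono H_pl_le) auto
    then have "\<kappa> + H (q i) \<le> \<alpha> / c * H (q i)" by (simp add: algebra_simps)
    ultimately show ?thesis using M N by linarith
  qed
  \<comment> \<open>The induction alternates: the gain bound after one block yields the price bound
    through \<open>price\<close>, and this bounds what the next block can add.\<close>
  have gain: "gain alg (A i) \<le> \<Psi> (Y i)" if "i \<le> Suc N" for i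
    using that
  proof (induction i)
    case 0
    then show ?case by (simp add: A_def Y_def Psi_0)
  next
    case (Suc i)
    have "q i \<le> \<phi> (Y i)"
    proof (cases i)
      case 0
      then show ?thesis using phi_range by (simp add: q_def)
    next
      case (Suc j)
      have "q i = q j + (pu - pl) / N" by (simp only: Suc q_def of_nat_Suc distrib_left mult_1_right)
      then have "H (q i) - H (q j) \<le> (pu - pl) / N"
        using H_lipschitz[of "q j" "q i"] pl_le_pu by simp
      then have "H (q i) \<le> H (\<phi> (Y i))" using price[of j] Suc.IH Suc.prems Suc by simp
      then show ?thesis using q[of i] Suc.prems phi_range by (simp add: H_le_iff)
    qed
    moreover have "Y i \<le> Y (Suc i)"
      unfolding Y_def A_def using M(1) by (rule used_staircase_mono)
    ultimately have "q i * (Y (Suc i) - Y i) \<le> \<phi> (Y i) * (Y (Suc i) - Y i)"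
      by (intro mult_right_mono) auto
    also have "\<dots> \<le> \<Psi> (Y (Suc i)) - \<Psi> (Y i)"
      using Y[of i] Y[of "Suc i"] Suc.prems \<open>Y i \<le> Y (Suc i)\<close> by (intro Psi_slope) auto
    finally show ?case
      using gain_block[of alg "A i" M "1 / M" "q i"] Suc by (simp add: A_def Y_def)
  qed
  have "H pu < H (\<phi> (Y (Suc N)))"
  proof -
    have "0 \<le> (pu - pl) / N" using pl_le_pu by simp
    then show ?thesis using price[of N] gain[of "Suc N"] unfolding q_end by simp
  qed
  then show False
    using H_le_iff[of "\<phi> (Y (Suc N))" pu] phi_range pl_le_pu by (simp flip: not_le)
qed

lemma competitive_ratio_ge:
  assumes "online_algorithm pl pu alg"
  shows "ereal \<alpha> \<le> competitive_ratio f pl pu alg"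
proof (rule ccontr)
  assume "\<not> ?thesis"
  then have "competitive_ratio f pl pu alg < ereal \<alpha>" by simp
  \<comment> \<open>The intermediate ratio must also be positive, since the adversary divides by
    it.\<close>
  moreover have "ereal 0 < ereal \<alpha>" using alpha_pos by simp
  ultimately obtain c where "max (competitive_ratio f pl pu alg) (ereal 0) < ereal c" "c < \<alpha>"
    using ereal_dense2[of "max (competitive_ratio f pl pu alg) (ereal 0)" "ereal \<alpha>"] by auto
  then have c: "competitive_ratio f pl pu alg < ereal c" "0 < c" "c < \<alpha>" by auto
  then obtain \<epsilon> where "\<epsilon> > 0"
    "\<forall>A\<in>instances pl pu \<epsilon>. offline_welfare f A \<le> c * online_welfare f alg A"
    using competitive_ratio_lessD[OF c(1)] by auto
  then show False using adversary_beats[OF assms c(2,3), of \<epsilon>] by force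
qed

end

subsection \<open>Posted price mechanisms\<close>

lemma pm_util_snoc:
  "pm_util \<phi> (A @ [\<theta>]) =
    pm_util \<phi> A + (if pm_accept \<phi> (pm_util \<phi> A) \<theta> then fst \<theta> else 0)"
  by (simp add: pm_util_def)

lemma pm_alloc_snoc: "pm_alloc \<phi> (A @ [\<theta>]) = pm_accept \<phi> (pm_util \<phi> A) \<theta>"
  by (simp add: pm_alloc_def)

lemma used_pm: "used (pm_alloc \<phi>) A = pm_util \<phi> A"
proof (induction A rule: rev_induct)
  case Nil
  then show ?case by (simp add: pm_util_def)
next
  case (snoc \<theta> A)
  then show ?case by (simp add: used_snoc pm_util_snoc pm_alloc_snoc)
qed

lemma pm_util_le_1: "pm_util \<phi> A \<le> 1"
proof (induction A rule: rev_induct)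
  case Nil
  then show ?case by (simp add: pm_util_def)
next
  case (snoc \<theta> A)
  then show ?case by (auto simp: pm_util_snoc pm_accept_def)
qed

lemma pm_util_nonneg: "(\<And>\<theta>. \<theta> \<in> set A \<Longrightarrow> 0 < fst \<theta>) \<Longrightarrow> 0 \<le> pm_util \<phi> A"
  using used_nonneg[of A "pm_alloc \<phi>"] by (simp add: used_pm)

lemma pm_util_take_mono:
  assumes "\<And>\<theta>. \<theta> \<in> set A \<Longrightarrow> 0 < fst \<theta>"
  shows "pm_util \<phi> (take n A) \<le> pm_util \<phi> A"
  using used_append_ge[of "drop n A" "pm_alloc \<phi>" "take n A"] assms
  by (auto simp: used_pm dest: in_set_dropD)

lemma online_algorithm_pm: "online_algorithm pl pu (pm_alloc \<phi>)"
  using pm_util_le_1 by (simp add: online_algorithm_def flip: used_def used_pm)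

text \<open>The current price depends on earlier reports only. Reporting a larger amount raises the
  payment without raising the value, a smaller amount yields no value, and a truthful report buys
  exactly when the request fits and is worth its price.\<close>

lemma incentive_compatible_PM:
  assumes "\<And>y. 0 \<le> y \<Longrightarrow> y \<le> 1 \<Longrightarrow> 0 \<le> \<phi> y"
  shows "incentive_compatible pl pu (PM \<phi>)"
  unfolding incentive_compatible_def
proof (intro allI impI)
  fix A :: "agent list" and \<theta> \<theta>' :: agent
  assume *: "(\<forall>\<eta>\<in>set A. 0 < fst \<eta>) \<and> valid_agent pl pu \<theta> \<and> 0 < fst \<theta>'"
  define y where "y = pm_util \<phi> A"
  have y: "0 \<le> \<phi> y" unfolding y_def using * by (intro assms pm_util_nonneg pm_util_le_1) auto
  have \<theta>: "0 < fst \<theta>" "0 < fst \<theta>'" using * by (auto simp: valid_agent_def)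
  have U: "utility (PM \<phi>) A \<theta> \<eta> = (if pm_accept \<phi> y \<eta> \<and> fst \<theta> \<le> fst \<eta> then ereal (snd \<theta>) else 0)
      - \<phi> y * ereal (fst \<eta>) * (if pm_accept \<phi> y \<eta> then 1 else 0)" for \<eta>
    by (simp add: utility_def PM_def pm_pay_def pm_alloc_snoc y_def)
  show "utility (PM \<phi>) A \<theta> \<theta>' \<le> utility (PM \<phi>) A \<theta> \<theta>"
  proof (cases "\<phi> y")
    case (real c)
    then have "0 \<le> c" using y by simp
    then have "0 \<le> c * fst \<theta>'" "fst \<theta> \<le> fst \<theta>' \<Longrightarrow> c * fst \<theta> \<le> c * fst \<theta>'"
      using \<theta> by (auto intro: mult_left_mono)
    then show ?thesis
      unfolding U real by (auto simp: pm_accept_def real zero_ereal_def one_ereal_def)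
  next
    case PInf
    then have "\<not> pm_accept \<phi> y \<theta>" "\<not> pm_accept \<phi> y \<theta>'"
      using \<theta> by (auto simp: pm_accept_def)
    then show ?thesis by (simp add: U)
  qed (use y in simp)
qed

section \<open>The optimal price attains the ratio\<close>

context optimal_threshold_ode
begin

abbreviation "opt_price" where "opt_price \<equiv> pricing_function f pl pu \<omega> \<phi>"

lemma pricing_eq: "0 \<le> y \<Longrightarrow> opt_price y = (if y \<le> \<rho> pu then ereal (\<phi> y) else \<infinity>)"
  using omega_le by (auto simp: pricing_function_def phi_flat)

lemma pm_accept_iff:
  assumes "0 \<le> y" "0 < fst \<theta>"
  shows "pm_accept opt_price y \<theta> \<longleftrightarrow>
    y \<le> \<rho> pu \<and> \<phi> y * fst \<theta> \<le> snd \<theta> \<and> y + fst \<theta> \<le> 1"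
  using assms by (auto simp: pm_accept_def pricing_eq zero_ereal_def)

lemma pricing_incentive_compatible: "incentive_compatible pl pu (PM opt_price)"
  using pl_pos phi_range by (intro incentive_compatible_PM) (auto simp: pricing_eq intro: less_imp_le order_trans)

text \<open>The real-valued \<phi> can stand for the posted price because, on valid histories,
  acceptance happens only up to \<open>\<rho> pu\<close>, where the two agree.\<close>

definition paid :: "agent list \<Rightarrow> real" where
  "paid A = (\<Sum>n\<in>accepted (pm_alloc opt_price) A. \<phi> (pm_util opt_price (take n A)) * fst (A ! n))"

lemma paid_snoc:
  "paid (A @ [\<theta>]) = paid A
    + (if pm_alloc opt_price (A @ [\<theta>]) then \<phi> (pm_util opt_price A) * fst \<theta> else 0)"
  unfolding paid_def by (rule sum_accepted_snoc[where g = "\<lambda>B \<theta>. \<phi> (pm_util opt_price B) * fst \<theta>"])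

text \<open>A lower Riemann sum of an increasing function misses at most the mesh times the variation.\<close>

lemma Psi_le_paid:
  assumes "\<And>\<theta>. \<theta> \<in> set A \<Longrightarrow> 0 < fst \<theta> \<and> fst \<theta> \<le> \<epsilon>"
  shows "\<Psi> (pm_util opt_price A) + \<epsilon> * pl \<le> paid A + \<epsilon> * \<phi> (pm_util opt_price A)"
  using assms
proof (induction A rule: rev_induct)
  case Nil
  then show ?case
    using phi_flat[of 0] omega_nonneg by (simp add: pm_util_def paid_def accepted_def Psi_0)
next
  case (snoc \<theta> A)
  let ?y = "pm_util opt_price A" and ?r = "fst \<theta>"
  have IH: "\<Psi> ?y + \<epsilon> * pl \<le> paid A + \<epsilon> * \<phi> ?y" and r: "0 < ?r" "?r \<le> \<epsilon>"
    using snoc by auto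
  show ?case
  proof (cases "pm_accept opt_price ?y \<theta>")
    case True
    have y: "0 \<le> ?y" using snoc.prems by (intro pm_util_nonneg) auto
    then have "?y + ?r \<le> 1" using True r by (simp add: pm_accept_iff)
    then have "\<Psi> (?y + ?r) - \<Psi> ?y \<le> \<phi> (?y + ?r) * ?r" "\<phi> ?y \<le> \<phi> (?y + ?r)"
      using Psi_slope(2)[of ?y "?y + ?r"] phi_mono[of ?y "?y + ?r"] y r by auto
    moreover have "0 \<le> (\<epsilon> - ?r) * (\<phi> (?y + ?r) - \<phi> ?y)"
      using r calculation by simp
    ultimately have "\<Psi> (?y + ?r) + \<epsilon> * pl \<le> paid A + \<phi> ?y * ?r + \<epsilon> * \<phi> (?y + ?r)"
      using IH by (simp add: algebra_simps)
    then show ?thesis using True by (simp add: pm_util_snoc paid_snoc pm_alloc_snoc)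
  next
    case False
    then show ?thesis using IH by (simp add: pm_util_snoc paid_snoc pm_alloc_snoc)
  qed
qed

text \<open>Infinite prices stop every sale beyond \<open>\<rho> pu\<close>, so only the last
  accepted agent can cross it.\<close>

lemma pm_util_overshoot:
  assumes "\<And>\<theta>. \<theta> \<in> set A \<Longrightarrow> 0 < fst \<theta> \<and> fst \<theta> \<le> \<epsilon>" "0 < \<epsilon>"
  shows "pm_util opt_price A \<le> \<rho> pu + \<epsilon>"
  using assms(1)
proof (induction A rule: rev_induct)
  case Nil
  then show ?case using rho_nonneg[of pu] assms(2) by (simp add: pm_util_def)
next
  case (snoc \<theta> A)
  have "0 \<le> pm_util opt_price A" using snoc.prems by (intro pm_util_nonneg) auto
  moreover have r: "0 < fst \<theta>" "fst \<theta> \<le> \<epsilon>" using snoc.prems by auto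
  moreover have "pm_util opt_price A \<le> \<rho> pu + \<epsilon>" using snoc by simp
  ultimately show ?case using pm_accept_iff[of _ \<theta>] by (simp add: pm_util_snoc)
qed

text \<open>\<open>S\<close> is the surplus of the accepted agents over posted prices, and
  \<open>z\<close> stands for the net revenue \<Psi> - \<open>f\<close> at a utilization near the
  final one. The bound on \<open>\<alpha> * z\<close> from below later turns the additive error into
  a relative one; the first alternative covers the instances where it would fail.\<close>

lemma pricing_welfare:
  assumes A: "A \<in> instances pl pu \<epsilon>" and \<epsilon>: "0 < \<epsilon>"
  defines "online \<equiv> online_welfare f (pm_alloc opt_price) A"
  shows "offline_welfare f A \<le> online \<or>
    (\<exists>S z. 0 \<le> S \<and> H pl \<le> \<alpha> * z \<and> offline_welfare f A \<le> S + \<alpha> * z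
      \<and> S + z - (2 * pu + m 1) * \<epsilon> \<le> online)"
proof -
  define y where "y n = pm_util opt_price (take n A)" for n
  define Y where "Y = pm_util opt_price A"
  \<comment> \<open>The shift by \<epsilon> makes every rejection for lack of room, or at an
    infinite price, force \<open>\<phi> z = pu\<close>, so that such agents are never worth more
    than \<open>\<phi> z\<close>.\<close>
  define z where "z = min (\<rho> pu) (Y + \<epsilon>)"
  define acc where "acc = accepted (pm_alloc opt_price) A"
  have ag: "0 < fst (A ! n)" "fst (A ! n) \<le> \<epsilon>" "pl * fst (A ! n) \<le> snd (A ! n)"
    "snd (A ! n) \<le> pu * fst (A ! n)" if "n < length A" for n
    using instances_valid[OF A, of "A ! n"] that by auto
  have y: "0 \<le> y n" "y n \<le> Y" for n
  proof -
    show "0 \<le> y n" unfolding y_def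
      by (rule pm_util_nonneg) (use instances_valid(1)[OF A] in \<open>auto dest: in_set_takeD\<close>)
    show "y n \<le> Y" unfolding y_def Y_def
      by (rule pm_util_take_mono) (rule instances_valid(1)[OF A])
  qed
  have Y: "Y \<in> {0..1}" "Y \<le> \<rho> pu + \<epsilon>"
    unfolding Y_def using instances_valid(1,2)[OF A] \<epsilon>
    by (auto intro!: pm_util_nonneg pm_util_le_1 pm_util_overshoot)
  have z: "z \<in> {0..1}" "z \<le> \<rho> pu" "\<bar>z - Y\<bar> \<le> \<epsilon>"
    using Y \<epsilon> rho_argmax[of pu] by (auto simp: z_def)
  have acc_iff: "n \<in> acc \<longleftrightarrow> y n \<le> \<rho> pu \<and> \<phi> (y n) * fst (A ! n) \<le> snd (A ! n)
      \<and> y n + fst (A ! n) \<le> 1" if "n < length A" for n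
    using that y ag(1)[OF that] pm_accept_iff[of "y n" "A ! n"]
    by (simp add: acc_def accepted_def take_Suc_conv_app_nth pm_alloc_snoc y_def)
  have acc_len: "acc \<subseteq> {..<length A}" unfolding acc_def by (rule accepted_less)
  have fin: "finite acc" by (simp add: acc_def)
  have demand_acc: "demand A acc = Y"
    using used_pm[of "opt_price" A] by (simp add: used_def acc_def Y_def)
  have online_eq: "online = (\<Sum>n\<in>acc. snd (A ! n)) - f Y"
    using used_pm[of "opt_price" A] by (simp add: online_def online_welfare_eq gain_def acc_def Y_def)
  show ?thesis
  proof (cases "z < \<omega>")
    case True
    then have z_eq: "Y + \<epsilon> < \<omega>" using omega_le by (auto simp: z_def)
    have all: "acc = {..<length A}"
    proof -
      have "n \<in> acc" if "n < length A" for n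
        using y[of n] ag[OF that] z_eq omega_le rho_le_1[of pu] \<epsilon> phi_flat[of "y n"]
        by (simp add: acc_iff[OF that])
      then show ?thesis using acc_len by auto
    qed
    \<comment> \<open>Accepting everyone is optimal here: a dropped agent is worth at least
      \<open>pl\<close> per unit, and on the flat segment \<open>pl * y - f y\<close> is
      increasing.\<close>
    have "welfare f A X \<le> online" if X: "X \<subseteq> {..<length A}" for X
    proof -
      have "0 \<le> demand A X" unfolding demand_def using X ag(1)
        by (intro sum_nonneg) (auto intro: less_imp_le)
      have sub: "demand A ({..<length A} - X) = Y - demand A X"
        using demand_acc X by (simp add: demand_def all sum_diff)
      have "pl * demand A ({..<length A} - X) \<le> (\<Sum>n\<in>{..<length A} - X. snd (A ! n))"
        unfolding demand_def sum_distrib_left using ag by (intro sum_mono) auto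
      moreover have "0 \<le> demand A ({..<length A} - X)" unfolding demand_def using ag(1)
        by (intro sum_nonneg) (auto intro: less_imp_le)
      then have "w (demand A X) \<le> w Y"
        using \<open>0 \<le> demand A X\<close> sub z_eq omega_le \<epsilon> by (intro w_mono) auto
      then have "pl * demand A X - f (demand A X) \<le> pl * Y - f Y"
        using \<open>0 \<le> demand A X\<close> \<open>0 \<le> demand A (_ - X)\<close> sub z_eq \<epsilon> Y by (simp add: w_def Psi_flat)
      moreover have "(\<Sum>n\<in>{..<length A} - X. snd (A ! n)) =
          (\<Sum>n\<in>acc. snd (A ! n)) - (\<Sum>n\<in>X. snd (A ! n))"
        using X by (simp add: all sum_diff)
      ultimately show ?thesis unfolding welfare_def online_eq sub by (simp add: algebra_simps)
    qed
    then show ?thesis by (intro disjI1 offline_welfare_le)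
  next
    case False
    define S where "S = (\<Sum>n\<in>acc. snd (A ! n) - \<phi> (y n) * fst (A ! n))"
    have S_term: "0 \<le> snd (A ! n) - \<phi> (y n) * fst (A ! n)" if "n \<in> acc" for n
      using acc_iff that acc_len by auto
    have "\<phi> z = pu" if "\<rho> pu < Y + \<epsilon>" using that phi_end[of z] z by (simp add: z_def)
    then have price: "n \<notin> acc \<Longrightarrow> snd (A ! n) \<le> \<phi> z * fst (A ! n)"
      "n \<in> acc \<Longrightarrow> \<phi> (y n) * fst (A ! n) \<le> \<phi> z * fst (A ! n)" if n: "n < length A" for n
    proof -
      have low: "\<phi> (y n) * fst (A ! n) \<le> \<phi> z * fst (A ! n)" if "y n \<le> \<rho> pu"
        using that y[of n] z ag[OF n] \<epsilon>
        by (intro mult_right_mono phi_mono) (auto simp: z_def)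
      then show "\<phi> (y n) * fst (A ! n) \<le> \<phi> z * fst (A ! n)" if "n \<in> acc"
        using that acc_iff[OF n] by simp
      have high: "snd (A ! n) \<le> \<phi> z * fst (A ! n)" if "\<rho> pu < Y + \<epsilon>"
        using ag[OF n] \<open>\<rho> pu < Y + \<epsilon> \<Longrightarrow> \<phi> z = pu\<close> that by simp
      assume "n \<notin> acc"
      then consider "\<rho> pu < y n" | "y n \<le> \<rho> pu" "snd (A ! n) < \<phi> (y n) * fst (A ! n)"
        | "1 < y n + fst (A ! n)"
        using acc_iff[OF n] by force
      then show "snd (A ! n) \<le> \<phi> z * fst (A ! n)"
      proof cases
        case 1
        then show ?thesis using y[of n] \<epsilon> by (intro high) linarith
      next
        case 2
        then show ?thesis using low by linarith
      next
        case 3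
        then show ?thesis using y[of n] ag(2)[OF n] rho_le_1[of pu] by (intro high) linarith
      qed
    qed
    have "welfare f A X \<le> S + \<alpha> * w z" if X: "X \<subseteq> {..<length A}" "demand A X \<le> 1" for X
    proof -
      have finX: "finite X" using X(1) finite_subset by blast
      \<comment> \<open>Weak duality at the single price \<open>\<phi> z\<close>: rejected agents
        contribute nothing positive, and accepted ones no more than their surplus at the lower price
        they paid.\<close>
      have "(\<Sum>n\<in>X. snd (A ! n) - \<phi> z * fst (A ! n))
          \<le> (\<Sum>n\<in>X. if n \<in> acc then snd (A ! n) - \<phi> (y n) * fst (A ! n) else 0)"
        using price X(1) by (intro sum_mono) auto
      also have "\<dots> = (\<Sum>n\<in>X \<inter> acc. snd (A ! n) - \<phi> (y n) * fst (A ! n))"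
        using finX by (simp add: sum.inter_restrict)
      also have "\<dots> \<le> S"
        unfolding S_def using fin S_term by (intro sum_mono2) auto
      finally have "(\<Sum>n\<in>X. snd (A ! n)) \<le> S + \<phi> z * demand A X"
        by (simp add: demand_def sum_subtractf sum_distrib_left)
      moreover have "\<phi> z * demand A X - f (demand A X) \<le> H (\<phi> z)"
        using X ag(1) unfolding demand_def
        by (intro H_ge) (auto intro!: sum_nonneg intro: less_imp_le)
      moreover have "H (\<phi> z) = \<alpha> * w z" using False z by (intro H_phi) auto
      ultimately show ?thesis by (simp add: welfare_def)
    qed
    then have "offline_welfare f A \<le> S + \<alpha> * w z" by (rule offline_welfare_le)
    moreover have "H pl \<le> \<alpha> * w z"
      using False z H_pl_le[OF phi_range(1), of z] H_phi[of z] by (simp add: not_less)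
    \<comment> \<open>One \<open>pu * \<epsilon>\<close> is the Riemann sum error of the payments;
      the rest is the Lipschitz bound for \<open>w\<close> between \<open>z\<close> and
      \<open>Y\<close>.\<close>
    moreover have "S + w z - (2 * pu + m 1) * \<epsilon> \<le> online"
    proof -
      have "(\<Sum>n\<in>acc. snd (A ! n)) = S + paid A"
        by (simp add: S_def paid_def acc_def y_def sum_subtractf)
      moreover have "\<Psi> Y + \<epsilon> * pl \<le> paid A + \<epsilon> * \<phi> Y"
        unfolding Y_def using instances_valid[OF A] by (intro Psi_le_paid) auto
      moreover have "\<epsilon> * \<phi> Y \<le> \<epsilon> * pu" "0 \<le> \<epsilon> * pl" using \<epsilon> phi_range pl_pos by auto
      moreover have "\<bar>w z - w Y\<bar> \<le> (pu + m 1) * \<epsilon>"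
      proof -
        have "\<bar>w z - w Y\<bar> \<le> (pu + m 1) * \<bar>z - Y\<bar>" using z Y by (intro w_lipschitz)
        also have "\<dots> \<le> (pu + m 1) * \<epsilon>"
          using z pl_pos pl_le_pu m_nonneg[of 1] by (intro mult_left_mono) auto
        finally show ?thesis .
      qed
      moreover have "(2 * pu + m 1) * \<epsilon> = (pu + m 1) * \<epsilon> + \<epsilon> * pu" by (simp add: algebra_simps)
      ultimately show ?thesis unfolding online_eq by (simp add: w_def[of Y])
    qed
    moreover have "0 \<le> S" unfolding S_def using S_term by (rule sum_nonneg)
    ultimately show ?thesis by blast
  qed
qed

lemma competitive_ratio_pricing_le: "competitive_ratio f pl pu (pm_alloc opt_price) \<le> ereal \<alpha>"
proof (rule competitive_ratio_leI[OF online_algorithm_pm alpha_ge_1])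
  fix \<delta> :: real assume \<delta>: "0 < \<delta>"
  define K where "K = 2 * pu + m 1"
  have K: "0 < K" using pl_pos pl_le_pu m_nonneg[of 1] by (simp add: K_def)
  \<comment> \<open>Chosen so that the total error equals
    \<open>\<delta> * (H pl / \<alpha>)\<close>, which the extra \<delta> times the net revenue
    covers.\<close>
  define \<epsilon> where "\<epsilon> = \<delta> * (H pl / \<alpha>) / ((\<alpha> + \<delta>) * K)"
  have \<epsilon>: "0 < \<epsilon>" "(\<alpha> + \<delta>) * (K * \<epsilon>) = \<delta> * (H pl / \<alpha>)"
    using \<delta> K alpha_pos H_pl_pos by (auto simp: \<epsilon>_def)
  have "offline_welfare f A \<le> (\<alpha> + \<delta>) * online_welfare f (pm_alloc opt_price) A" (is "?off \<le> _ * ?on")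
    if A: "A \<in> instances pl pu \<epsilon>" for A
    using pricing_welfare[OF A \<epsilon>(1)]
  proof
    assume "?off \<le> ?on"
    moreover have "0 \<le> ?off" by (simp add: offline_welfare_nonneg)
    ultimately have "1 * ?on \<le> (\<alpha> + \<delta>) * ?on"
      using alpha_ge_1 \<delta> by (intro mult_right_mono) auto
    then show ?thesis using \<open>?off \<le> ?on\<close> by simp
  next
    assume "\<exists>S z. 0 \<le> S \<and> H pl \<le> \<alpha> * z \<and> ?off \<le> S + \<alpha> * z \<and> S + z - (2 * pu + m 1) * \<epsilon> \<le> ?on"
    then obtain S z where S: "0 \<le> S" "H pl \<le> \<alpha> * z" "?off \<le> S + \<alpha> * z" "S + z - K * \<epsilon> \<le> ?on"
      by (auto simp: K_def)
    have "?off \<le> S + \<alpha> * z" by (rule S)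
    also have "S \<le> (\<alpha> + \<delta>) * S"
      using mult_right_mono[of 1 "\<alpha> + \<delta>" S] alpha_ge_1 \<delta> S(1) by simp
    also have "H pl / \<alpha> \<le> z" using S(2) alpha_pos by (simp add: field_simps)
    then have "\<delta> * (H pl / \<alpha>) \<le> \<delta> * z" using \<delta> by (intro mult_left_mono) auto
    then have "(\<alpha> + \<delta>) * S + \<alpha> * z \<le> (\<alpha> + \<delta>) * (S + z - K * \<epsilon>)"
      using \<epsilon>(2) by (simp add: algebra_simps)
    also have "\<dots> \<le> (\<alpha> + \<delta>) * ?on"
      using S(4) alpha_pos \<delta> by (intro mult_left_mono) auto
    finally show ?thesis by simp
  qed
  then show "\<exists>\<epsilon>>0. \<forall>A\<in>instances pl pu \<epsilon>.
      offline_welfare f A \<le> (\<alpha> + \<delta>) * online_welfare f (pm_alloc opt_price) A"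
    using \<epsilon>(1) by blast
qed

lemma optimal_ratio_eq: "optimal_ratio f pl pu = ereal \<alpha>"
proof (rule antisym)
  have "optimal_ratio f pl pu \<le> competitive_ratio f pl pu (pm_alloc opt_price)"
    unfolding optimal_ratio_def using online_algorithm_pm by (intro INF_lower) simp
  then show "optimal_ratio f pl pu \<le> ereal \<alpha>"
    using competitive_ratio_pricing_le by (rule order_trans)
  show "ereal \<alpha> \<le> optimal_ratio f pl pu"
    unfolding optimal_ratio_def using competitive_ratio_ge by (intro INF_greatest) simp
qed

lemma optimal_pricing_pricing: "optimal_pricing f pl pu opt_price"
  using pricing_incentive_compatible competitive_ratio_pricing_le online_algorithm_pm
  by (simp add: optimal_pricing_def competitive_def PM_def optimal_ratio_eq)

end

subsection \<open>Uniqueness\<close>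

lemma pm_accept_density_iff:
  assumes "0 < r" "ereal c \<le> \<phi> y"
  shows "pm_accept \<phi> y (r, q * r) \<longleftrightarrow> \<phi> y \<le> ereal q \<and> y + r \<le> 1"
  using assms by (cases "\<phi> y") (auto simp: pm_accept_def zero_ereal_def)

text \<open>A run of identical agents stops being served only because of the price or for lack of
  room. The remaining alternative, that all are served, is ruled out later by blocks that fill the
  whole capacity.\<close>

lemma pm_util_block:
  fixes \<phi> :: "real \<Rightarrow> ereal" and q :: real
  assumes "0 < r" and A: "\<And>\<theta>. \<theta> \<in> set A \<Longrightarrow> 0 < fst \<theta>"
    and ge: "\<And>y. 0 \<le> y \<Longrightarrow> y \<le> 1 \<Longrightarrow> ereal c \<le> \<phi> y"
  defines "u n \<equiv> pm_util \<phi> (A @ replicate n (r, q * r))"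
  shows "ereal q < \<phi> (u n) \<or> 1 - r < u n \<or> u n = u 0 + n * r"
    and "1 - r < u 0 \<Longrightarrow> u n = u 0"
    and "(\<And>y. y0 < y \<Longrightarrow> y \<le> 1 \<Longrightarrow> ereal q < \<phi> y) \<Longrightarrow> u 0 \<le> y0 + r \<Longrightarrow> u n \<le> y0 + r"
proof -
  have u: "0 \<le> u n" "u n \<le> 1" for n
    unfolding u_def using assms(1) A by (auto intro!: pm_util_nonneg pm_util_le_1)
  have step: "u (Suc n) = u n + (if \<phi> (u n) \<le> ereal q \<and> u n + r \<le> 1 then r else 0)" for n
    using pm_util_snoc[of \<phi> "A @ replicate n (r, q * r)" "(r, q * r)"]
      pm_accept_density_iff[where \<phi> = \<phi>, OF assms(1) ge[OF u[of n]]]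
    by (simp add: u_def replicate_snoc del: replicate_Suc)
  show "ereal q < \<phi> (u n) \<or> 1 - r < u n \<or> u n = u 0 + n * r"
  proof (induction n)
    case (Suc n)
    then show ?case by (cases "\<phi> (u n) \<le> ereal q \<and> u n + r \<le> 1") (auto simp: step algebra_simps)
  qed simp
  show "u n = u 0" if "1 - r < u 0"
    using that by (induction n) (auto simp: step)
  show "u n \<le> y0 + r" if above: "\<And>y. y0 < y \<Longrightarrow> y \<le> 1 \<Longrightarrow> ereal q < \<phi> y" and "u 0 \<le> y0 + r"
  proof (induction n)
    case (Suc n)
    then show ?case using above[of "u n"] u(2)[of n] by (cases "y0 < u n") (auto simp: step)
  qed (rule that)
qed

lemma staircase_pos: "0 < M \<Longrightarrow> \<theta> \<in> set (staircase M q i) \<Longrightarrow> 0 < fst \<theta>"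
  by (induction i) auto

context market
begin

text \<open>A staircase that stops at density \<open>p\<close> fills the capacity up to the point \<open>y0\<close> where the price
  exceeds \<open>p\<close>; \<open>G\<close> stands for a primitive of the price.\<close>

lemma pm_staircase_bound:
  fixes \<phi> :: "real \<Rightarrow> ereal"
  assumes comp: "competitive_ratio f pl pu (pm_alloc \<phi>) \<le> ereal \<alpha>" and \<alpha>: "0 < \<alpha>"
    and p: "pl \<le> p" "p \<le> pu" and y0: "y0 \<in> {0..1}"
    and ge: "\<And>y. 0 \<le> y \<Longrightarrow> y \<le> 1 \<Longrightarrow> ereal pl \<le> \<phi> y"
    and mono: "\<And>a b. 0 \<le> a \<Longrightarrow> a \<le> b \<Longrightarrow> b \<le> 1 \<Longrightarrow> \<phi> a \<le> \<phi> b"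
    and below: "\<And>y. 0 \<le> y \<Longrightarrow> y \<le> y0 \<Longrightarrow> \<phi> y = ereal (\<psi> y) \<and> \<psi> y \<le> p"
    and above: "\<And>y. y0 < y \<Longrightarrow> y \<le> 1 \<Longrightarrow> ereal p < \<phi> y"
    and G: "G 0 = 0" "\<And>a b. 0 \<le> a \<Longrightarrow> a \<le> b \<Longrightarrow> b \<le> y0 \<Longrightarrow> \<psi> a * (b - a) \<le> G b - G a"
  shows "H p \<le> \<alpha> * (G y0 - f y0)"
proof (rule ccontr)
  define X where "X = G y0 - f y0"
  assume "\<not> ?thesis"
  then have gap: "0 < H p - \<alpha> * X" by (simp add: X_def)
  define \<kappa> where "\<kappa> = 1 + \<bar>X\<bar>"
  have \<kappa>: "0 < \<kappa>" "X \<le> \<kappa>" by (auto simp: \<kappa>_def)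
  \<comment> \<open>The ratio is a limit, so a strictly larger constant is needed to get an actual
    \<epsilon>; this \<delta> uses up at most half of the gap, and \<open>\<kappa>\<close> keeps the
    quotient safe for every sign of \<open>X\<close>.\<close>
  define \<delta> where "\<delta> = (H p - \<alpha> * X) / (2 * \<kappa>)"
  have \<delta>: "0 < \<delta>" unfolding \<delta>_def using gap \<kappa> by simp
  have "\<delta> * X \<le> \<delta> * \<kappa>" using \<delta> \<kappa> by (intro mult_left_mono) auto
  also have "\<dots> = (H p - \<alpha> * X) / 2" using \<kappa> by (simp add: \<delta>_def)
  finally have gap': "0 < H p - (\<alpha> + \<delta>) * X" using gap by (simp add: algebra_simps)
  have "competitive_ratio f pl pu (pm_alloc \<phi>) < ereal (\<alpha> + \<delta>)"
    using comp \<delta> by (simp add: le_less_trans)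
  then obtain \<epsilon> where \<epsilon>: "0 < \<epsilon>" "\<And>A. A \<in> instances pl pu \<epsilon> \<Longrightarrow>
      offline_welfare f A \<le> (\<alpha> + \<delta>) * online_welfare f (pm_alloc \<phi>) A"
    using competitive_ratio_lessD[of f pl pu "pm_alloc \<phi>" "\<alpha> + \<delta>"] by auto
  \<comment> \<open>The error terms are rounding of the offline optimum (\<open>pu\<close>),
    overshoot past \<open>y0\<close> (\<open>p\<close>), change of cost (\<open>m 1\<close>) and the
    density step (\<open>p - pl\<close>). One \<open>N\<close> serves both as mesh and as number of
    steps.\<close>
  define C where "C = pu + (\<alpha> + \<delta>) * (p + m 1 + (p - pl))"
  have ppos: "0 < p" "0 < pu" using p pl_pos by auto
  have C: "0 < C"
    unfolding C_def using ppos \<alpha> \<delta> p m_nonneg[of 1] by (intro add_pos_nonneg mult_nonneg_nonneg) auto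
  obtain N :: nat where N: "max (1 / \<epsilon>) (C / (H p - (\<alpha> + \<delta>) * X)) < N"
    using reals_Archimedean2 by blast
  moreover have "0 < 1 / \<epsilon>" using \<epsilon>(1) by simp
  ultimately have "0 < real N" by linarith
  then have N: "0 < N" "1 / N \<le> \<epsilon>" "C / N < H p - (\<alpha> + \<delta>) * X"
    using N \<epsilon>(1) gap' by (auto simp: field_simps)
  define d where "d = (p - pl) / N"
  have d: "0 \<le> d" using p by (simp add: d_def)
  define q where "q j = pl + d * real j" for j
  have q: "pl \<le> q j" "q j \<le> p" if "j \<le> N" for j
  proof -
    show "pl \<le> q j" using d by (simp add: q_def)
    have "d * real j \<le> d * real N" using that d by (intro mult_left_mono) auto
    then show "q j \<le> p" using N by (simp add: q_def d_def)
  qed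
  have q_end: "q N = p" using N by (simp add: q_def d_def)
  define A where "A i = staircase N q i" for i
  define Y where "Y i = pm_util \<phi> (A i)" for i
  have inst: "A i \<in> instances pl pu \<epsilon>" if "i \<le> Suc N" for i
    unfolding A_def
  proof (rule staircase_instance[OF N(1,2)])
    fix j assume "j < i"
    then show "pl \<le> q j \<and> q j \<le> pu" using q[of j] that p by simp
  qed
  have A_pos: "0 < fst \<theta>" if "\<theta> \<in> set (A i)" for \<theta> i
    using that staircase_pos[OF N(1)] unfolding A_def by blast
  have Y: "Y i \<in> {0..1}" for i
  proof -
    have "0 \<le> Y i" unfolding Y_def by (rule pm_util_nonneg) (rule A_pos)
    then show ?thesis using pm_util_le_1[of \<phi> "A i"] by (simp add: Y_def)
  qed
  have Y_mono: "Y i \<le> Y (Suc i)" for i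
    using used_staircase_mono[of N "pm_alloc \<phi>" q i] N by (simp add: Y_def A_def used_pm)
  have Y_Suc: "Y (Suc i) = pm_util \<phi> (A i @ replicate N (1 / N, q i * (1 / N)))" for i
    by (simp add: Y_def A_def)
  have block: "ereal (q i) < \<phi> (Y (Suc i)) \<or> 1 - 1 / N < Y (Suc i)"
    "1 - 1 / N < Y i \<Longrightarrow> Y (Suc i) = Y i"
    "i \<le> N \<Longrightarrow> Y i \<le> y0 + 1 / N \<Longrightarrow> Y (Suc i) \<le> y0 + 1 / N" for i
  proof -
    have r: "0 < 1 / real N" using N by simp
    have Y_0: "pm_util \<phi> (A i @ replicate 0 (1 / N, q i * (1 / N))) = Y i"
      by (simp add: Y_def)
    have "ereal (q i) < \<phi> (Y (Suc i)) \<or> 1 - 1 / N < Y (Suc i) \<or> Y (Suc i) = Y i + N * (1 / N)"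
      unfolding Y_Suc Y_0[symmetric]
      by (rule pm_util_block(1)[OF r A_pos[of _ i], where c = pl]) (auto intro: ge)
    then show "ereal (q i) < \<phi> (Y (Suc i)) \<or> 1 - 1 / N < Y (Suc i)"
    proof (elim disjE)
      assume "Y (Suc i) = Y i + N * (1 / N)"
      then have "1 \<le> Y (Suc i)" using N Y[of i] by simp
      then have "1 - 1 / N < Y (Suc i)" using r by linarith
      then show ?thesis ..
    qed auto
    show "Y (Suc i) = Y i" if "1 - 1 / N < Y i"
      using that unfolding Y_Suc Y_0[symmetric]
      by (rule pm_util_block(2)[OF r A_pos[of _ i], where c = pl, rotated -1]) (auto intro: ge)
    show "Y (Suc i) \<le> y0 + 1 / N" if "i \<le> N" "Y i \<le> y0 + 1 / N"
    proof -
      have q_less: "ereal (q i) < \<phi> y" if "y0 < y" "y \<le> 1" for y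
        using above[OF that] q(2)[OF \<open>i \<le> N\<close>] by (simp add: le_less_trans[of _ "ereal p"])
      show ?thesis
        unfolding Y_Suc
      proof (rule pm_util_block(3)[where c = pl])
        show "pm_util \<phi> (A i @ replicate 0 (1 / N, q i * (1 / N))) \<le> y0 + 1 / N"
          unfolding Y_0 by (rule that)
        show "0 < fst \<theta>" if "\<theta> \<in> set (A i)" for \<theta> using that by (rule A_pos)
      qed (fact r ge q_less)+
    qed
  qed
  \<comment> \<open>The last agent may carry the utilization past \<open>y0\<close>, so the
    primitive is continued there at the constant price \<open>p\<close>.\<close>
  define Gc where "Gc y = G (min y y0) + p * max 0 (y - y0)" for y
  define c where "c y = (if y \<le> y0 then \<psi> y else p)" for y
  have Gc_slope: "c a * (b - a) \<le> Gc b - Gc a" if "0 \<le> a" "a \<le> b" for a b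
  proof -
    consider "b \<le> y0" | "a \<le> y0" "y0 < b" | "y0 < a" by linarith
    then show ?thesis
    proof cases
      case 1
      then show ?thesis using G(2)[of a b] that by (simp add: Gc_def c_def)
    next
      case 2
      have "\<psi> a * (y0 - a) \<le> G y0 - G a" using G(2)[of a y0] that 2 by simp
      moreover have "\<psi> a * (b - y0) \<le> p * (b - y0)"
        using below[of a] that 2 by (intro mult_right_mono) auto
      moreover have "\<psi> a * (b - a) = \<psi> a * (y0 - a) + \<psi> a * (b - y0)" by (simp add: algebra_simps)
      moreover have "Gc b - Gc a = G y0 + p * (b - y0) - G a" "c a = \<psi> a"
        using 2 by (simp_all add: Gc_def c_def)
      ultimately show ?thesis by simp
    next
      case 3
      then show ?thesis using that by (simp add: Gc_def c_def algebra_simps)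
    qed
  qed
  \<comment> \<open>A block starts at a price above the previous density unless room is nearly
    exhausted, in which case it sells nothing. Its own density is larger by \<open>d\<close>, whence
    the correction \<open>d * Y i\<close>.\<close>
  have gain: "gain (pm_alloc \<phi>) (A i) \<le> Gc (Y i) + d * Y i" if "i \<le> Suc N" for i
    using that
  proof (induction i)
    case 0
    then show ?case using y0 G(1) by (simp add: A_def Y_def Gc_def pm_util_def)
  next
    case (Suc i)
    have "q i * (Y (Suc i) - Y i) \<le> (c (Y i) + d) * (Y (Suc i) - Y i)"
    proof (cases "1 - 1 / N < Y i")
      case True
      then show ?thesis using block(2) by simp
    next
      case False
      have "q i \<le> c (Y i) + d"
      proof (cases "Y i \<le> y0")
        case True
        show ?thesis
        proof (cases i)
          case 0
          have "ereal pl \<le> ereal (\<psi> (Y i))"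
            using ge[of "Y i"] below[of "Y i"] Y[of i] True by simp
          then show ?thesis using 0 True d by (simp add: q_def c_def)
        next
          case (Suc j)
          then have "ereal (q j) < ereal (\<psi> (Y i))"
            using block(1)[of j] below[of "Y i"] Y[of i] True False by simp
          moreover have "q i = q j + d" unfolding Suc q_def by (simp add: algebra_simps)
          ultimately show ?thesis using True by (simp add: c_def)
        qed
      next
        case False
        then show ?thesis using q[of i] Suc.prems d by (simp add: c_def)
      qed
      then show ?thesis using Y_mono by (intro mult_right_mono) auto
    qed
    also have "\<dots> \<le> Gc (Y (Suc i)) - Gc (Y i) + d * (Y (Suc i) - Y i)"
      using Gc_slope[of "Y i" "Y (Suc i)"] Y[of i] Y_mono by (simp add: algebra_simps)
    finally show ?case
      using gain_block[of "pm_alloc \<phi>" "A i" N "1 / N" "q i"] Suc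
      by (simp add: A_def Y_def used_pm algebra_simps)
  qed
  let ?Y = "Y (Suc N)"
  have "Y i \<le> y0 + 1 / N" if "i \<le> Suc N" for i
    using that
  proof (induction i)
    case 0
    then show ?case using y0 by (simp add: A_def Y_def pm_util_def)
  next
    case (Suc i)
    then show ?case using block(3)[of i] by simp
  qed
  then have up: "?Y \<le> y0 + 1 / N" by simp
  \<comment> \<open>If the final utilization is at most \<open>y0\<close>, the price there is at
    most \<open>p\<close>, so the last block can only have stopped for lack of room.\<close>
  have low: "y0 - 1 / N \<le> ?Y"
  proof (cases "?Y \<le> y0")
    case True
    then have "\<not> ereal p < \<phi> ?Y" using below[of ?Y] Y[of "Suc N"] by auto
    then have "1 - 1 / N < ?Y" using block(1)[of N] q_end by simp
    then show ?thesis using y0 by simp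
  next
    case False
    moreover have "0 < 1 / real N" using N by simp
    ultimately show ?thesis by linarith
  qed
  have "Gc ?Y \<le> G y0 + p / N"
  proof (cases "?Y \<le> y0")
    case True
    have "ereal pl \<le> ereal (\<psi> ?Y)"
      using ge[of ?Y] below[of ?Y] Y[of "Suc N"] True by simp
    then have "0 \<le> \<psi> ?Y * (y0 - ?Y)" using pl_pos True by simp
    then have "G ?Y \<le> G y0" using G(2)[of ?Y y0] Y[of "Suc N"] True by simp
    moreover have "0 \<le> p / N" using ppos by simp
    ultimately show ?thesis using True by (simp add: Gc_def)
  next
    case False
    have "p * (?Y - y0) \<le> p * (1 / N)" using up ppos by (intro mult_left_mono) auto
    then show ?thesis using False by (simp add: Gc_def)
  qed
  moreover have "d * ?Y \<le> d" using Y[of "Suc N"] d by (simp add: mult_left_le)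
  moreover have "f y0 - f ?Y \<le> m 1 / N"
  proof -
    have "f y0 - f ?Y \<le> m 1 * \<bar>y0 - ?Y\<bar>"
      using f_lipschitz[of y0 ?Y] y0 Y[of "Suc N"] by simp
    also have "\<dots> \<le> m 1 * (1 / N)"
      using up low m_nonneg[of 1] by (intro mult_left_mono) auto
    finally show ?thesis by simp
  qed
  ultimately have "gain (pm_alloc \<phi>) (A (Suc N)) - f ?Y \<le> X + (p + m 1 + (p - pl)) / N"
    using gain[of "Suc N"] unfolding X_def add_divide_distrib d_def by linarith
  then have "(\<alpha> + \<delta>) * (gain (pm_alloc \<phi>) (A (Suc N)) - f ?Y) \<le>
      (\<alpha> + \<delta>) * (X + (p + m 1 + (p - pl)) / N)"
    using \<alpha> \<delta> by (intro mult_left_mono) auto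
  moreover have "H p - pu / N \<le> (\<alpha> + \<delta>) * (gain (pm_alloc \<phi>) (A (Suc N)) - f ?Y)"
    using offline_staircase[of N q N] \<epsilon>(2)[OF inst, of "Suc N"] N q_end ppos p
    by (simp add: A_def Y_def used_pm online_welfare_eq del: staircase.simps)
  ultimately have "H p - pu / N \<le> (\<alpha> + \<delta>) * X + (\<alpha> + \<delta>) * (p + m 1 + (p - pl)) / N"
    by (simp add: distrib_left)
  then show False using N(3) by (simp add: C_def add_divide_distrib)
qed

end

context optimal_threshold_ode
begin

lemma omega_in: "\<omega> \<in> {0..1}"
  using omega_nonneg omega_le rho_le_1[of pu] by simp

text \<open>The slack is the revenue difference \<Psi> - \<open>G\<close>, where \<open>G\<close> is
  the revenue of the other price. It starts at 0, is nondecreasing because the other price is never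
  higher, and is at most 0 at \<open>\<rho> pu\<close>; so it vanishes and the prices agree.\<close>

lemma critical_threshold_unique:
  assumes crit: "critical_threshold f pl pu \<phi>' \<omega>'"
    and opt: "optimal_pricing f pl pu \<phi>'"
  shows "\<omega>' = \<omega>" and "\<And>y. y \<in> {0..\<rho> pu} \<Longrightarrow> \<phi>' y = ereal (\<phi> y)"
proof -
  have comp: "competitive_ratio f pl pu (pm_alloc \<phi>') \<le> ereal \<alpha>"
    using opt by (simp add: optimal_pricing_def competitive_def PM_def optimal_ratio_eq)
  have om: "0 \<le> \<omega>'" "\<omega>' \<le> \<rho> pu"
    and flat: "\<And>y. 0 \<le> y \<Longrightarrow> y \<le> \<omega>' \<Longrightarrow> \<phi>' y = ereal pl"
    and cont: "continuous_on {\<omega>'..\<rho> pu} \<phi>'"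
    and incr: "\<And>a b. \<omega>' \<le> a \<Longrightarrow> a < b \<Longrightarrow> b \<le> \<rho> pu \<Longrightarrow> \<phi>' a < \<phi>' b"
    and inf: "\<And>y. \<rho> pu < y \<Longrightarrow> \<phi>' y = \<infinity>"
    using crit by (auto simp: critical_threshold_def strict_mono_on_def)
  have incr': "\<phi>' a < \<phi>' b" if "\<omega>' \<le> a" "a < b" "\<phi>' a < \<infinity>" for a b
    using incr[of a b] inf[of b] that by (cases "b \<le> \<rho> pu") auto
  have ge: "ereal pl \<le> \<phi>' y" if "0 \<le> y" for y
    using flat[of y] flat[of \<omega>'] incr'[of \<omega>' y] om that by (cases "y \<le> \<omega>'") auto
  have mono: "\<phi>' a \<le> \<phi>' b" if "0 \<le> a" "a \<le> b" for a b
  proof (cases "a \<le> \<omega>'")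
    case True
    then show ?thesis using flat[of a] ge[of b] that by simp
  next
    case False
    then show ?thesis using incr[of a b] inf[of b] that
      by (cases "a = b"; cases "b \<le> \<rho> pu") auto
  qed
  \<comment> \<open>Instances of density \<open>pl\<close> alone require \<open>\<alpha> * w\<close>
    to reach \<open>H pl\<close> before the price leaves \<open>pl\<close>, and \<omega> is the
    first such point.\<close>
  have omega_le': "\<omega> \<le> \<omega>'"
  proof (rule ccontr)
    assume "\<not> \<omega> \<le> \<omega>'"
    have "H pl \<le> \<alpha> * (pl * \<omega>' - f \<omega>')"
    proof (rule pm_staircase_bound[OF comp alpha_pos, where \<psi> = "\<lambda>_. pl" and G = "\<lambda>y. pl * y"])
      show "ereal pl < \<phi>' y" if "\<omega>' < y" for y
        using incr'[of \<omega>' y] flat[of \<omega>'] om that by simp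
      show "\<omega>' \<in> {0..1}" using om rho_le_1[of pu] by simp
    qed (use ge mono flat pl_le_pu in \<open>auto simp: algebra_simps\<close>)
    then have "H pl \<le> \<alpha> * w \<omega>'" using \<open>\<not> \<omega> \<le> \<omega>'\<close> om by (simp add: w_def Psi_flat)
    moreover have "\<alpha> * w \<omega>' < \<alpha> * w \<omega>"
      using \<open>\<not> \<omega> \<le> \<omega>'\<close> om omega_le alpha_pos by (intro mult_strict_left_mono w_strict_mono) auto
    ultimately show False using w_omega by simp
  qed
  define \<psi> where "\<psi> y = real_of_ereal (\<phi>' y)" for y
  define G where "G y = integral {0..y} \<psi>" for y
  define D where "D y = \<Psi> y - G y" for y
  have segment: "\<phi>' y = ereal (\<psi> y) \<and> pl \<le> \<psi> y \<and> \<psi> y \<le> pu"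
    if "0 \<le> y" "y \<le> b" "b \<le> \<rho> pu" "\<phi>' b \<le> ereal pu" for y b
  proof -
    have "\<phi>' y \<le> ereal pu" using mono[OF that(1,2)] that(4) by (rule order_trans)
    then show ?thesis using ge[OF that(1)] unfolding \<psi>_def by (cases "\<phi>' y") auto
  qed
  have G_deriv: "(G has_real_derivative \<psi> y) (at y within {0..b})"
    if "y \<in> {0..b}" "\<omega>' \<le> b" "b \<le> \<rho> pu" "\<phi>' b \<le> ereal pu" for y b
  proof -
    have "continuous_on ({0..\<omega>'} \<union> {\<omega>'..b}) \<phi>'"
    proof (rule continuous_on_closed_Un)
      show "continuous_on {0..\<omega>'} \<phi>'"
        by (subst continuous_on_cong[OF refl, of _ _ "\<lambda>_. ereal pl"]) (auto simp: flat)
      show "continuous_on {\<omega>'..b} \<phi>'"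
        using that by (intro continuous_on_subset[OF cont]) auto
    qed auto
    moreover have "{0..\<omega>'} \<union> {\<omega>'..b} = {0..b}" using that om by auto
    ultimately have "continuous_on {0..b} \<phi>'" by simp
    moreover have "\<bar>\<phi>' x\<bar> \<noteq> \<infinity>" if "x \<in> {0..b}" for x
      using segment[of x b] that \<open>b \<le> \<rho> pu\<close> \<open>\<phi>' b \<le> ereal pu\<close> by auto
    ultimately have "continuous_on {0..b} (real_of_ereal \<circ> \<phi>')"
      by (metis continuous_on_iff_real)
    then have "continuous_on {0..b} \<psi>" by (simp add: \<psi>_def[abs_def] o_def)
    then show ?thesis unfolding G_def using that(1) by (rule integral_has_real_derivative)
  qed
  have G_0: "G 0 = 0" by (simp add: G_def)
  have G_slope: "\<psi> a * (c - a) \<le> G c - G a"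
    if "0 \<le> a" "a \<le> c" "c \<le> b" "\<omega>' \<le> b" "b \<le> \<rho> pu" "\<phi>' b \<le> ereal pu" for a c b
  proof (rule increment_ge[where g' = \<psi>])
    have Gb: "(G has_real_derivative \<psi> x) (at x within {0..b})" if "x \<in> {0..b}" for x
      using G_deriv that \<open>\<omega>' \<le> b\<close> \<open>b \<le> \<rho> pu\<close> \<open>\<phi>' b \<le> ereal pu\<close> by blast
    show "continuous_on {a..c} G"
      using that by (intro continuous_on_subset[OF DERIV_continuous_on[OF Gb]]) auto
    show "(G has_real_derivative \<psi> x) (at x)" if "a < x" "x < c" for x
      using Gb[of x] at_within_Icc_at[of 0 x b] that \<open>0 \<le> a\<close> \<open>c \<le> b\<close> by simp
    show "\<psi> a \<le> \<psi> x" if "a < x" "x < c" for x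
      using segment[of a b] segment[of x b] mono[of a x] that \<open>0 \<le> a\<close> \<open>c \<le> b\<close>
        \<open>b \<le> \<rho> pu\<close> \<open>\<phi>' b \<le> ereal pu\<close> by simp
  qed (rule that)
  have bound: "H p \<le> \<alpha> * (w b - D b)"
    if "\<omega>' \<le> b" "b \<le> \<rho> pu" "\<phi>' b \<le> ereal p" "p \<le> pu"
      "\<And>y. b < y \<Longrightarrow> ereal p < \<phi>' y" for b p
  proof -
    have b: "\<phi>' b \<le> ereal pu" using that(3,4) by (simp add: order_trans[of _ "ereal p"])
    have "ereal pl \<le> \<phi>' b" using om that by (intro ge) auto
    then have "ereal pl \<le> ereal p" using that(3) by (rule order_trans)
    then have "H p \<le> \<alpha> * (G b - f b)"
    proof (intro pm_staircase_bound[OF comp alpha_pos, where \<psi> = \<psi>])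
      show "\<phi>' y = ereal (\<psi> y) \<and> \<psi> y \<le> p" if "0 \<le> y" "y \<le> b" for y
      proof -
        have "\<phi>' y \<le> ereal p" using mono[OF that] \<open>\<phi>' b \<le> ereal p\<close> by (rule order_trans)
        then show ?thesis using segment[of y b] that b \<open>b \<le> \<rho> pu\<close> by simp
      qed
      show "\<psi> a * (c - a) \<le> G c - G a" if "0 \<le> a" "a \<le> c" "c \<le> b" for a c
        using G_slope[of a c b] that b \<open>\<omega>' \<le> b\<close> \<open>b \<le> \<rho> pu\<close> by simp
    qed (use that ge mono om rho_le_1[of pu] G_0 in auto)
    then show ?thesis by (simp add: D_def w_def)
  qed
  have D_0: "D 0 = 0" by (simp add: D_def Psi_0 G_0)
  \<comment> \<open>Stated only up to points with \<open>\<phi>' b \<le> ereal pu\<close>, where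
    \<phi>' is finite and the staircase bound applies. If \<psi> exceeds \<phi>, the bound at
    density \<open>\<psi> t\<close> and \<open>H_growth\<close> give the Gronwall inequality; on the
    flat segment of \<phi>' no excess is possible.\<close>
  have compare: "0 \<le> D y \<and> \<psi> y \<le> \<phi> y"
    if b: "\<omega>' \<le> b" "b \<le> \<rho> pu" "\<phi>' b \<le> ereal pu" and y: "0 \<le> y" "y \<le> b" for y b
  proof -
    have b1: "b \<le> 1" using b rho_le_1[of pu] by simp
    have D_deriv: "(D has_real_derivative \<phi> t - \<psi> t) (at t within {0..b})" if "t \<in> {0..b}" for t
      unfolding D_def using that b b1 G_deriv[of t b]
      by (intro DERIV_diff DERIV_subset[OF Psi_deriv]) auto
    have below: "H (\<psi> t) \<le> H (\<phi> t) - \<alpha> * D t" if "\<omega>' \<le> t" "t \<le> b" for t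
    proof -
      have t: "\<phi>' t = ereal (\<psi> t)" "\<psi> t \<le> pu" using segment[of t b] that b om by auto
      then have "H (\<psi> t) \<le> \<alpha> * (w t - D t)"
        using incr'[of t] that b by (intro bound) auto
      moreover have "\<alpha> * w t \<le> H (\<phi> t)" using that om b1 by (intro w_le_H_phi) auto
      ultimately show ?thesis by (simp add: right_diff_distrib)
    qed
    have \<psi>_flat: "\<psi> t = pl" if "0 \<le> t" "t \<le> \<omega>'" for t
      using flat[OF that] by (simp add: \<psi>_def)
    have \<psi>_ge: "pl \<le> \<psi> t" if "0 \<le> t" "t \<le> b" for t using segment[of t b] that b by simp
    have "0 \<le> D t" if t: "0 \<le> t" "t \<le> b" for t
    proof (rule nonneg_by_gronwall[where a = 0 and D = D and K = "\<alpha> / \<rho> pl"])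
      show "continuous_on {0..t} D"
        using t by (intro continuous_on_subset[OF DERIV_continuous_on[OF D_deriv]]) auto
      fix s assume s: "0 < s" "s < t" "D s < 0"
      have "\<alpha> / \<rho> pl * D s \<le> \<phi> s - \<psi> s"
      proof (cases "\<psi> s \<le> \<phi> s")
        case True
        moreover have "\<alpha> / \<rho> pl * D s \<le> 0"
          using s alpha_nonneg rho_pl_pos by (intro mult_nonneg_nonpos) auto
        ultimately show ?thesis by linarith
      next
        case False
        then have "\<omega>' \<le> s" using \<psi>_flat[of s] phi_range[of s] s by force
        then have "\<rho> pl * (\<psi> s - \<phi> s) \<le> - (\<alpha> * D s)"
          using H_growth[OF phi_range(1)[of s], of "\<psi> s"] below[of s] False s t by simp
        then show ?thesis using rho_pl_pos by (simp add: field_simps)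
      qed
      moreover have "(D has_real_derivative \<phi> s - \<psi> s) (at s)"
        using D_deriv[of s] at_within_Icc_at[of 0 s b] s t by simp
      ultimately show "\<exists>D'. (D has_real_derivative D') (at s) \<and> \<alpha> / \<rho> pl * D s \<le> D'"
        by blast
    qed (use t D_0 in auto)
    then have D: "0 \<le> D y" using y by simp
    moreover have "\<psi> y \<le> \<phi> y"
    proof (cases "y \<le> \<omega>'")
      case True
      then show ?thesis using \<psi>_flat[of y] phi_range y by simp
    next
      case False
      have "0 \<le> \<alpha> * D y" using D alpha_nonneg by simp
      then have "H (\<psi> y) \<le> H (\<phi> y)" using below[of y] False y by simp
      then show ?thesis using H_le_iff \<psi>_ge[OF y] phi_range by blast
    qed
    ultimately show ?thesis ..
  qed
  have "\<omega>' = \<omega> \<and> (\<forall>y\<in>{0..\<rho> pu}. \<phi>' y = ereal (\<phi> y))"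
  \<comment> \<open>In the degenerate case \<open>pl = pu\<close> the increasing segment is a single
    point, and the flat part alone determines the price.\<close>
  proof (cases "\<omega> = \<rho> pu")
    case True
    then show ?thesis using om omega_le' flat phi_flat by auto
  next
    case False
    \<comment> \<open>A price above \<open>pu\<close> at the end would equal \<open>pu\<close> at an
      earlier point by continuity, where \<phi> is still strictly smaller; this contradicts the
      comparison up to that point.\<close>
    have peak': "\<phi>' (\<rho> pu) \<le> ereal pu"
    proof (rule ccontr)
      assume "\<not> ?thesis"
      then have gt: "ereal pu < \<phi>' (\<rho> pu)" by simp
      then obtain b where b: "\<omega>' \<le> b" "b \<le> \<rho> pu" "\<phi>' b = ereal pu"
        using IVT'[of \<phi>' \<omega>' "ereal pu" "\<rho> pu"] flat[of \<omega>'] om cont pl_le_pu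
          less_imp_le[OF gt] by auto
      then have "\<psi> b \<le> \<phi> b" using compare[of b b] om by simp
      moreover have "\<phi> b < \<phi> (\<rho> pu)"
        using b gt omega_le' by (intro phi_strict_mono) (auto simp: order_le_less)
      ultimately show False using b phi_end[of "\<rho> pu"] rho_le_1[of pu] by (simp add: \<psi>_def)
    qed
    note cmp = compare[OF om(2) order_refl peak']
    have "H pu \<le> \<alpha> * (w (\<rho> pu) - D (\<rho> pu))"
      using om peak' inf by (intro bound) auto
    then have "D (\<rho> pu) \<le> 0"
      using peak alpha_pos by (simp add: right_diff_distrib mult_le_0_iff)
    have R: "0 < \<rho> pu" "\<rho> pu \<le> 1" using rho_pu_pos rho_le_1 by auto
    have D_deriv: "(D has_real_derivative \<phi> t - \<psi> t) (at t within {0..\<rho> pu})"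
      if "t \<in> {0..\<rho> pu}" for t
      unfolding D_def using that R G_deriv[OF that om(2) order_refl peak']
      by (intro DERIV_diff DERIV_subset[OF Psi_deriv]) auto
    have "D t = 0" if t: "t \<in> {0..\<rho> pu}" for t
    proof -
      have "0 * (\<rho> pu - t) \<le> D (\<rho> pu) - D t"
      proof (rule increment_ge[where g' = "\<lambda>t. \<phi> t - \<psi> t"])
        show "continuous_on {t..\<rho> pu} D"
          using t by (intro continuous_on_subset[OF DERIV_continuous_on[OF D_deriv]]) auto
        show "(D has_real_derivative \<phi> x - \<psi> x) (at x)" if "t < x" "x < \<rho> pu" for x
          using D_deriv[of x] at_within_Icc_at[of 0 x "\<rho> pu"] t that by simp
        show "0 \<le> \<phi> x - \<psi> x" if "t < x" "x < \<rho> pu" for x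
          using cmp[of x] t that by simp
      qed (use t in simp)
      then show ?thesis using cmp[of t] t \<open>D (\<rho> pu) \<le> 0\<close> by simp
    qed
    \<comment> \<open>Uniqueness of derivatives within the closed interval gives equality of the
      prices at both endpoints as well.\<close>
    then have "(D has_real_derivative 0) (at t within {0..\<rho> pu})" if "t \<in> {0..\<rho> pu}" for t
      using that by (subst has_field_derivative_cong_eventually[where g = "\<lambda>_. 0"])
        (auto simp: eventually_at_filter)
    then have \<psi>_eq: "\<psi> t = \<phi> t" if "t \<in> {0..\<rho> pu}" for t
      using vector_derivative_unique_within_closed_interval[OF R(1), of t D 0 "\<phi> t - \<psi> t"]
        D_deriv[OF that] that
      by (simp add: has_real_derivative_iff_has_vector_derivative)
    have eq: "\<phi>' t = ereal (\<phi> t)" if "t \<in> {0..\<rho> pu}" for t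
      using segment[of t "\<rho> pu"] \<psi>_eq[OF that] that peak' by simp
    have "\<omega>' = \<omega>"
    proof (rule ccontr)
      assume "\<omega>' \<noteq> \<omega>"
      then have "\<phi> \<omega> < \<phi> \<omega>'" using omega_le' om by (intro phi_strict_mono) auto
      then show False
        using eq[of \<omega>'] flat[of \<omega>'] om phi_range[of \<omega>] by simp
    qed
    then show ?thesis using eq by blast
  qed
  then show "\<omega>' = \<omega>" "\<And>y. y \<in> {0..\<rho> pu} \<Longrightarrow> \<phi>' y = ereal (\<phi> y)" by auto
qed

section \<open>The boundary value problem and the closed formulas\<close>

lemma critical_threshold_pricing: "critical_threshold f pl pu opt_price \<omega>"
proof -
  have eq: "opt_price y = ereal (\<phi> y)" if "y \<in> {0..\<rho> pu}" for y
    using that by (simp add: pricing_eq)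
  have "continuous_on {\<omega>..\<rho> pu} (\<lambda>y. ereal (\<phi> y))"
    using omega_nonneg rho_le_1[of pu]
    by (intro continuous_on_ereal continuous_on_subset[OF phi_continuous]) auto
  then have "continuous_on {\<omega>..\<rho> pu} opt_price"
    using eq omega_nonneg by (subst continuous_on_cong[OF refl, of _ _ "\<lambda>y. ereal (\<phi> y)"]) auto
  moreover have "strict_mono_on {\<omega>..\<rho> pu} opt_price"
    using omega_nonneg by (auto simp: strict_mono_on_def eq phi_strict_mono)
  moreover have "opt_price y = \<infinity>" if "\<rho> pu < y" for y
    using that rho_nonneg[of pu] by (simp add: pricing_eq)
  ultimately show ?thesis
    using omega_nonneg omega_le by (auto simp: critical_threshold_def eq phi_flat)
qed

text \<open>Chain rule for \<open>price_of (\<alpha> * w t)\<close>: the outer derivative is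
  \<open>1 / h'\<close> at the price, and \<open>w\<close> has derivative price minus marginal
  cost.\<close>

lemma bvp_solution_phi: "bvp_solution f pl pu \<omega> \<phi>"
proof -
  have "(\<phi> has_real_derivative \<alpha> * ((\<phi> y - m y) / deriv H (\<phi> y))) (at y)"
    if y: "y \<in> {\<omega><..<\<rho> pu}" for y
  proof -
    have y1: "0 < y" "y < 1" using y omega_nonneg rho_le_1[of pu] by auto
    have "\<phi> \<omega> < \<phi> y" "\<phi> y < \<phi> (\<rho> pu)" using y by (auto intro!: phi_strict_mono)
    then have "pl < \<phi> y" "\<phi> y < pu"
      using phi_flat[of \<omega>] phi_end[of "\<rho> pu"] omega_nonneg rho_le_1[of pu] by auto
    then have "(price_of has_real_derivative inverse (\<rho> (\<phi> y))) (at (\<alpha> * w y))"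
      using price_of_deriv[of "\<phi> y"] H_phi[of y] y by simp
    moreover have "((\<lambda>t. \<alpha> * w t) has_real_derivative \<alpha> * (\<phi> y - m y)) (at y)"
      using w_deriv_at[OF y1] by (rule DERIV_cmult)
    ultimately have "((\<lambda>t. price_of (\<alpha> * w t)) has_real_derivative
        inverse (\<rho> (\<phi> y)) * (\<alpha> * (\<phi> y - m y))) (at y)"
      by (rule DERIV_chain2)
    then have "(\<phi> has_real_derivative inverse (\<rho> (\<phi> y)) * (\<alpha> * (\<phi> y - m y))) (at y)"
      by (rule has_field_derivative_transform_within_open[of _ _ _ "{\<omega><..<\<rho> pu}"])
         (use y phi_eq_w in auto)
    moreover have "deriv H (\<phi> y) = \<rho> (\<phi> y)" using H_deriv by (rule DERIV_imp_deriv)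
    ultimately show ?thesis by (simp add: divide_inverse mult_ac)
  qed
  moreover have "continuous_on {\<omega>..\<rho> pu} \<phi>"
    using omega_nonneg rho_le_1[of pu] by (intro continuous_on_subset[OF phi_continuous]) auto
  moreover have "strict_mono_on {\<omega>..\<rho> pu} \<phi>"
    by (auto simp: strict_mono_on_def phi_strict_mono)
  ultimately show ?thesis
    using phi_flat[of \<omega>] phi_end[of "\<rho> pu"] omega_nonneg rho_le_1[of pu]
    by (simp add: bvp_solution_def optimal_ratio_eq)
qed

text \<open>In the variable \<open>H \<circ> g\<close> the equation becomes Lipschitz, even though \<open>deriv H\<close> need not be.\<close>

lemma bvp_solution_unique:
  assumes g: "bvp_solution f pl pu \<omega> g" and y: "y \<in> {\<omega>..\<rho> pu}"
  shows "g y = \<phi> y"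
proof -
  have g_cont: "continuous_on {\<omega>..\<rho> pu} g" and g_om: "g \<omega> = pl"
    and g_deriv: "\<And>t. t \<in> {\<omega><..<\<rho> pu} \<Longrightarrow>
      (g has_real_derivative \<alpha> * ((g t - m t) / \<rho> (g t))) (at t)"
    using g DERIV_imp_deriv[OF H_deriv] by (auto simp: bvp_solution_def optimal_ratio_eq)
  have g_ge: "pl \<le> g t" if "t \<in> {\<omega>..\<rho> pu}" for t
    using g g_om that by (cases "t = \<omega>") (auto simp: bvp_solution_def strict_mono_on_def less_imp_le)
  define E where "E t = H (g t) - \<alpha> * w t" for t
  have E_om: "E \<omega> = 0" by (simp add: E_def g_om w_omega)
  have E_deriv: "(E has_real_derivative \<alpha> * (g t - \<phi> t)) (at t)" if t: "t \<in> {\<omega><..<\<rho> pu}" for t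
  proof -
    have t1: "0 < t" "t < 1" using t omega_nonneg rho_le_1[of pu] by auto
    have "0 < \<rho> (g t)" using rho_pl_pos rho_mono[of pl "g t"] g_ge[of t] t by auto
    moreover have "((\<lambda>t. H (g t)) has_real_derivative \<rho> (g t) * (\<alpha> * ((g t - m t) / \<rho> (g t)))) (at t)"
      by (rule DERIV_chain2[OF H_deriv g_deriv[OF t]])
    ultimately have "((\<lambda>t. H (g t)) has_real_derivative \<alpha> * (g t - m t)) (at t)" by simp
    from DERIV_diff[OF this DERIV_cmult[OF w_deriv_at[OF t1], of \<alpha>]]
    show ?thesis unfolding E_def by (simp add: algebra_simps)
  qed
  have E_eq: "E t = H (g t) - H (\<phi> t)" if "t \<in> {\<omega>..\<rho> pu}" for t
    using that by (simp add: E_def H_phi)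
  \<comment> \<open>A competing solution may rise above \<open>pu\<close>, but it stays at or above
    \<open>pl\<close>, which is all that the growth bound of \<open>H\<close> needs.\<close>
  have gap: "\<rho> pl * \<bar>g t - \<phi> t\<bar> \<le> \<bar>E t\<bar>" if "t \<in> {\<omega>..\<rho> pu}" for t
    using H_growth[OF g_ge[OF that], of "\<phi> t"] H_growth[OF phi_range(1), of t "g t"] E_eq[OF that]
    by (cases "g t \<le> \<phi> t") auto
  have E_cont: "continuous_on {\<omega>..y} E"
  proof -
    have "continuous_on {\<omega>..\<rho> pu} (\<lambda>t. H (g t))"
      by (rule continuous_on_compose2[OF H_continuous[of UNIV] g_cont]) simp
    then show ?thesis unfolding E_def using y omega_nonneg rho_le_1[of pu]
      by (intro continuous_intros continuous_on_subset[OF w_continuous])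
        (auto elim: continuous_on_subset)
  qed
  have key: "\<alpha> / \<rho> pl * - \<bar>E t\<bar> \<le> - \<bar>\<alpha> * (g t - \<phi> t)\<bar>" if "t \<in> {\<omega>..\<rho> pu}" for t
  proof -
    have "\<alpha> / \<rho> pl * (\<rho> pl * \<bar>g t - \<phi> t\<bar>) \<le> \<alpha> / \<rho> pl * \<bar>E t\<bar>"
      using gap[OF that] alpha_nonneg rho_pl_pos by (intro mult_left_mono) auto
    then show ?thesis using rho_pl_pos alpha_nonneg by (simp add: abs_mult)
  qed
  have "0 \<le> E y"
  proof (rule nonneg_by_gronwall[where a = \<omega> and D = E and K = "\<alpha> / \<rho> pl"])
    fix t assume t: "\<omega> < t" "t < y" "E t < 0"
    then have "\<alpha> / \<rho> pl * E t \<le> \<alpha> * (g t - \<phi> t)" using key[of t] y by simp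
    then show "\<exists>D'. (E has_real_derivative D') (at t) \<and> \<alpha> / \<rho> pl * E t \<le> D'"
      using E_deriv[of t] t y by auto
  qed (use E_cont E_om y in auto)
  moreover have "0 \<le> - E y"
  proof (rule nonneg_by_gronwall[where a = \<omega> and D = "\<lambda>t. - E t" and K = "\<alpha> / \<rho> pl"])
    fix t assume t: "\<omega> < t" "t < y" "- E t < 0"
    then have "\<alpha> / \<rho> pl * - E t \<le> - (\<alpha> * (g t - \<phi> t))" using key[of t] y by simp
    moreover have "((\<lambda>t. - E t) has_real_derivative - (\<alpha> * (g t - \<phi> t))) (at t)"
      using E_deriv[of t] t y by (intro DERIV_minus) auto
    ultimately show "\<exists>D'. ((\<lambda>t. - E t) has_real_derivative D') (at t) \<and> \<alpha> / \<rho> pl * - E t \<le> D'"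
      by blast
  qed (use E_cont E_om y in \<open>auto intro: continuous_on_minus\<close>)
  ultimately have "H (g y) = H (\<phi> y)" using E_eq[OF y] by simp
  then show ?thesis using H_inj[OF g_ge[OF y] phi_range(1)] by simp
qed

lemma optimal_threshold_iff: "optimal_threshold f pl pu \<omega>' \<longleftrightarrow> \<omega>' = \<omega>"
  using critical_threshold_unique(1) critical_threshold_pricing optimal_pricing_pricing
  unfolding optimal_threshold_def by blast

lemma optimal_ratio_formula: "optimal_ratio f pl pu = ereal (H pl / (pl * \<omega> - f \<omega>))"
proof -
  have "w \<omega> = pl * \<omega> - f \<omega>" using omega_nonneg by (simp add: w_def Psi_flat)
  moreover have "w \<omega> \<noteq> 0" using w_omega H_pl_pos by auto
  moreover have "\<alpha> = H pl / w \<omega>"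
    using w_omega \<open>w \<omega> \<noteq> 0\<close> by (simp add: nonzero_eq_divide_eq)
  ultimately show ?thesis by (simp add: optimal_ratio_eq)
qed

end

text \<open>For \<open>pl\<close> strictly between the extreme marginal costs the maximizer is
  interior, so both halves of the first-order condition hold.\<close>

lemma (in market) the_inv_marginal:
  assumes "pl \<in> {m 0<..<m 1}"
  shows "the_inv_into {0..1} m pl = \<rho> pl"
proof (rule the_inv_into_f_eq)
  show "inj_on m {0..1}"
    using m_strict_mono by (intro linorder_inj_onI) (auto simp: less_le)
  have "\<rho> pl < 1" using m_rho_le[OF rho_pl_pos] rho_le_1[of pl] assms by (cases "\<rho> pl = 1") auto
  then show "m (\<rho> pl) = pl" using m_rho_le[OF rho_pl_pos] m_rho_ge[of pl] by simp
qed (use rho_argmax[of pl] in simp)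

theorem theorem3:
  fixes f :: "real \<Rightarrow> real" and pl pu :: real
  assumes "convex_setup f pl pu"
  shows "\<exists>\<omega>.
     (\<forall>\<omega>'. optimal_threshold f pl pu \<omega>' \<longleftrightarrow> \<omega>' = \<omega>) \<and>
     optimal_ratio f pl pu = ereal (h f pl) / profit f pl \<omega> \<and>
     (pl \<in> {marginal f 0<..<marginal f 1} \<longrightarrow>
        optimal_ratio f pl pu =
          ereal ((pl * the_inv_into {0..1} (marginal f) pl - f (the_inv_into {0..1} (marginal f) pl))
                 / (pl * \<omega> - f \<omega>))) \<and>
     (marginal f 1 \<le> pl \<longrightarrow>
        optimal_ratio f pl pu = ereal ((pl - f 1) / (pl * \<omega> - f \<omega>))) \<and>
     (\<exists>g. bvp_solution f pl pu \<omega> g \<and>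
        (\<forall>g'. bvp_solution f pl pu \<omega> g' \<longrightarrow> (\<forall>y\<in>{\<omega>..rho_bar f pu}. g' y = g y)) \<and>
        critical_threshold f pl pu (pricing_function f pl pu \<omega> g) \<omega> \<and>
        optimal_pricing f pl pu (pricing_function f pl pu \<omega> g) \<and>
        (\<forall>\<phi>. critical_threshold f pl pu \<phi> \<omega> \<and> optimal_pricing f pl pu \<phi> \<longrightarrow>
           (\<forall>y\<ge>0. \<phi> y = pricing_function f pl pu \<omega> g y)))"
proof -
  interpret market f pl pu using assms by unfold_locales
  obtain \<alpha> \<Psi> \<omega> where "optimal_threshold_ode f pl pu \<alpha> \<Psi> \<omega>"
    using optimal_threshold_ode_exists by blast
  then interpret optimal_threshold_ode f pl pu \<alpha> \<Psi> \<omega> .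
  have "0 < w \<omega>" using w_omega H_pl_pos alpha_pos by (metis zero_less_mult_pos)
  \<comment> \<open>Positivity makes the extended-real quotient in the claim agree with the real
    one.\<close>
  then have "0 < pl * \<omega> - f \<omega>" using omega_nonneg by (simp add: w_def Psi_flat)
  then have ratio: "optimal_ratio f pl pu = ereal (h f pl) / profit f pl \<omega>"
    using omega_in by (simp add: optimal_ratio_formula profit_eq)
  have high: "h f pl = pl - f 1" if "marginal f 1 \<le> pl"
  proof -
    have "\<rho> pl = 1" using le_rhoI[of 1 pl] rho_le_1[of pl] that by simp
    then show ?thesis by (simp add: H_eq)
  qed
  have unique: "\<phi>' y = opt_price y"
    if "critical_threshold f pl pu \<phi>' \<omega>" "optimal_pricing f pl pu \<phi>'" "0 \<le> y" for \<phi>' y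
    using critical_threshold_unique(2)[OF that(1,2), of y] that
    by (cases "y \<le> \<rho> pu") (auto simp: pricing_eq critical_threshold_def)
  show ?thesis
  proof (intro exI[of _ \<omega>] conjI impI allI)
    show "\<exists>g. bvp_solution f pl pu \<omega> g \<and>
        (\<forall>g'. bvp_solution f pl pu \<omega> g' \<longrightarrow> (\<forall>y\<in>{\<omega>..rho_bar f pu}. g' y = g y)) \<and>
        critical_threshold f pl pu (pricing_function f pl pu \<omega> g) \<omega> \<and>
        optimal_pricing f pl pu (pricing_function f pl pu \<omega> g) \<and>
        (\<forall>\<phi>. critical_threshold f pl pu \<phi> \<omega> \<and> optimal_pricing f pl pu \<phi> \<longrightarrow>
           (\<forall>y\<ge>0. \<phi> y = pricing_function f pl pu \<omega> g y))"
      using bvp_solution_phi bvp_solution_unique critical_threshold_pricing optimal_pricing_pricing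
        unique by blast
    show "optimal_ratio f pl pu =
        ereal ((pl * the_inv_into {0..1} (marginal f) pl - f (the_inv_into {0..1} (marginal f) pl))
          / (pl * \<omega> - f \<omega>))" if "pl \<in> {marginal f 0<..<marginal f 1}"
      using the_inv_marginal[OF that] by (simp add: optimal_ratio_formula H_eq)
    show "optimal_ratio f pl pu = ereal ((pl - f 1) / (pl * \<omega> - f \<omega>))"
      if "marginal f 1 \<le> pl"
      using high[OF that] by (simp add: optimal_ratio_formula)
  qed (fact optimal_threshold_iff ratio)+
qed

end
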